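(* Let $k\ge 3$ be an integer and let $\varepsilon\in(0,1)$. There is a constant $p_0=p_0(k,\varepsilon)$ (any sufficiently large constant in terms of $k$ and $\varepsilon$ will do) such that the following holds. Let $X_1,\dots,X_k,D\in[1,\infty)$ with $D\le \min(X_1,\dots,X_k)$, let $\delta\in(0,1]$, and let $A_i\subset[X_i,2X_i]$ ($1\le i\le k$) be sets of integers such that $\gcd(a_1,\dots,a_k)\ge D$ for at least $\delta\prod_{i=1}^k|A_i|$ tuples $(a_1,\dots,a_k)\in\prod_{i=1}^kA_i$. Then $$\prod_{i=1}^k|A_i|\le C_k^{\,1+\#\mathscr{P}_{\mathrm{small}}\left(\bigcup_{i=1}^kA_i\right)}\;\delta^{-\frac{k+\varepsilon/(k-1)}{k-1}}\;\frac{\prod_{i=1}^kX_i}{D^k},\qquad C_k=2^{4k}.$$ In particular, $$\prod_{i=1}^k|A_i|\ll_{\varepsilon,k}\delta^{-\frac{k}{k-1}-\varepsilon}\,\frac{\prod_{i=1}^kX_i}{D^k},$$ where the implied constant depends only on $k$ and $\varepsilon$.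
   Context: For a set $S$ of positive integers, $\mathscr{P}(S)$ denotes the set of primes dividing at least one element of $S$, and $\mathscr{P}_{\mathrm{small}}(S):=\{p\in\mathscr{P}(S):p\le p_0\}$. *)

theory Defs
  imports Complex_Main "HOL-Library.FuncSet" "HOL-Computational_Algebra.Primes"
begin

definition prime_support :: "nat set \<Rightarrow> nat set" where
  "prime_support S = {p. prime p \<and> (\<exists>n\<in>S. p dvd n)}"

definition prime_support_small :: "real \<Rightarrow> nat set \<Rightarrow> nat set" where
  "prime_support_small p0 S = {p \<in> prime_support S. real p \<le> p0}"

definition big_gcd_tuples :: "nat \<Rightarrow> real \<Rightarrow> (nat \<Rightarrow> nat set) \<Rightarrow> (nat \<Rightarrow> nat) set" where
  "big_gcd_tuples k D A =
     {a \<in> (\<Pi>\<^sub>E i\<in>{1..k}. A i). real (Gcd (a ` {1..k})) \<ge> D}"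

text \<open>
  The standing hypotheses on the data. Since every \<open>X i\<close> is at least 1, the integers in
  \<open>[X i, 2 X i]\<close> are positive, so the sets \<open>A i\<close> are taken as sets of natural numbers; they
  are automatically finite and may be empty. Only the indices \<open>1, \<dots>, k\<close> matter.
\<close>
definition gcd_setup ::
  "nat \<Rightarrow> (nat \<Rightarrow> real) \<Rightarrow> real \<Rightarrow> real \<Rightarrow> (nat \<Rightarrow> nat set) \<Rightarrow> bool" where
  "gcd_setup k X D \<delta> A \<longleftrightarrow>
     (\<forall>i\<in>{1..k}. 1 \<le> X i) \<and> 1 \<le> D \<and> D \<le> Min (X ` {1..k}) \<and>
     0 < \<delta> \<and> \<delta> \<le> 1 \<and>
     (\<forall>i\<in>{1..k}. \<forall>a\<in>A i. X i \<le> real a \<and> real a \<le> 2 * X i) \<and>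
     real (card (big_gcd_tuples k D A)) \<ge> \<delta> * (\<Prod>i=1..k. real (card (A i)))"

end

theory Submission
  imports Defs "HOL-Analysis.Convex" "HOL-Analysis.Summation_Tests"
begin

text \<open>
  Put \<open>e = \<epsilon> / (k - 1)\<close>, \<open>\<mu> = (k - 1) / (k + e)\<close>, \<open>r = 1 - \<mu>\<close>. The claim is equivalent to a bound
  \<open>(C T)\<^sup>\<mu> N\<^sup>r\<close> for the number of tuples with large gcd, where \<open>T = \<Prod>X i / D\<^sup>k\<close> and
  \<open>N = \<Prod>|A i|\<close>. It is proved by induction on the set of primes dividing the elements. Split the
  tuples according to their \<open>p\<close>-adic valuations and divide out the powers of \<open>p\<close>: by induction the
  claim follows if a certain sum over valuation patterns, depending only on the distribution of
  the valuations in each \<open>A i\<close>, is at most \<open>1\<close>. For a small prime this sum is at most \<open>C\<^sup>\<mu>\<close>, which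
  costs one factor \<open>C\<close>. For a large prime, the sum can exceed \<open>1\<close> only if for some \<open>m\<close> all but
  \<open>O(1/p)\<close> of the elements of each \<open>A i\<close> have valuation \<open>m\<close>, and then the tuples
  whose gcd has valuation different from \<open>m\<close> contribute only \<open>O(p\<^sup>-\<^sup>1\<^sup>-\<^sup>\<eta>)\<close>, since \<open>k \<ge> 3\<close>. If this
  happens at every prime, these contributions sum to at most \<open>1/2\<close>, so half of the tuples share one
  gcd \<open>G \<ge> D\<close>, and there are at most \<open>\<Prod>(2 X i / G) \<le> 2\<^sup>k T\<close> such tuples.
\<close>

subsection \<open>Sums over valuation patterns\<close>

text \<open>AM-GM for the powers \<open>x i powr (card I * r)\<close>. It turns a product over
  coordinates into a sum, so that sums over valuations can be carried out one coordinate at a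
  time.\<close>

lemma prod_powr_le_mean:
  fixes x :: "'i \<Rightarrow> real" and r :: real
  assumes "finite I" "I \<noteq> {}" "\<And>i. i \<in> I \<Longrightarrow> 0 \<le> x i"
  shows "(\<Prod>i\<in>I. x i powr r) \<le> (\<Sum>i\<in>I. x i powr (card I * r)) / card I"
proof -
  have k: "real (card I) > 0" using assms by (simp add: card_gt_0_iff)
  have "(\<Prod>i\<in>I. x i powr r) = (\<Prod>i\<in>I. (x i powr (card I * r)) powr (1 / card I))"
    using k by (intro prod.cong refl) (simp add: powr_powr)
  also have "\<dots> = (\<Prod>i\<in>I. x i powr (card I * r)) powr (1 / card I)"
    by (rule prod_powr_distrib[symmetric])
  also have "\<dots> \<le> (\<Sum>i\<in>I. x i powr (card I * r) / card I)"
    using assms by (intro arith_geom_mean) auto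
  finally show ?thesis by (simp add: sum_divide_distrib)
qed

text \<open>
  \<open>x i n\<close> is the proportion of elements of \<open>A i\<close> with valuation \<open>n\<close>. A pattern of valuations is
  written as \<open>l + d i\<close>, where \<open>l\<close> is the valuation of the gcd, so that \<open>d\<close> vanishes somewhere.
  In the application \<open>\<theta>\<close> is \<open>p\<close> to the power \<open>- \<mu>\<close>: dividing by \<open>p\<close> to the power \<open>l + d i\<close> in each
  coordinate divides \<open>\<Prod>X i / D\<^sup>k\<close> by \<open>p\<close> to the power \<open>\<Sum>d i\<close>.
\<close>
locale profile =
  fixes I :: "'i set" and M :: nat and x :: "'i \<Rightarrow> nat \<Rightarrow> real" and r \<theta> :: real
  assumes finite_I: "finite I" and I_nonempty: "I \<noteq> {}"
    and x_nonneg: "i \<in> I \<Longrightarrow> 0 \<le> x i n"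
    and x_beyond: "i \<in> I \<Longrightarrow> n > M \<Longrightarrow> x i n = 0"
    and x_sum: "i \<in> I \<Longrightarrow> (\<Sum>n\<le>M. x i n) = 1"
    and r_pos: "0 < r" and r_le_1: "r \<le> 1" and kr_ge_1: "1 \<le> card I * r"
    and \<theta>_pos: "0 < \<theta>" and \<theta>_less_1: "\<theta> < 1"
begin

definition shifts :: "('i \<Rightarrow> nat) set" where
  "shifts = {d \<in> I \<rightarrow>\<^sub>E {..M}. \<exists>i\<in>I. d i = 0}"

definition weight :: "nat \<Rightarrow> ('i \<Rightarrow> nat) \<Rightarrow> real" where
  "weight l d = \<theta> ^ (\<Sum>i\<in>I. d i) * (\<Prod>i\<in>I. x i (l + d i) powr r)"

section \<open>Bounds for pattern sums of an arbitrary profile\<close>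

lemma card_pos: "0 < card I"
  using finite_I I_nonempty by (simp add: card_gt_0_iff)

lemma finite_shifts: "finite shifts"
  by (rule finite_subset[of _ "I \<rightarrow>\<^sub>E {..M}"]) (auto simp: shifts_def finite_I finite_PiE)

lemma weight_nonneg: "0 \<le> weight l d"
  unfolding weight_def using \<theta>_pos by (auto intro!: mult_nonneg_nonneg prod_nonneg)

lemma x_le_1: "i \<in> I \<Longrightarrow> x i n \<le> 1"
proof (cases "n \<le> M")
  case True
  assume i: "i \<in> I"
  show "x i n \<le> 1"
    unfolding x_sum[OF i, symmetric] by (rule member_le_sum) (use True i x_nonneg in auto)
qed (simp add: x_beyond)

lemma x_off_le:
  assumes "i \<in> I" "n \<noteq> m"
  shows "x i n \<le> 1 - x i m"
proof (cases "n \<le> M \<and> m \<le> M")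
  case True
  have "(\<Sum>j\<in>{n, m}. x i j) \<le> (\<Sum>j\<le>M. x i j)"
    by (rule sum_mono2) (use True assms x_nonneg in auto)
  then show ?thesis using assms x_sum by simp
next
  case False
  then show ?thesis using x_beyond x_le_1[OF assms(1)] assms by (metis diff_zero linorder_not_le diff_ge_0_iff_ge)
qed

text \<open>The shift by \<open>a\<close> is injective and there is no mass beyond \<open>M\<close>,
  so at most the total mass 1 without the mass at \<open>m\<close> is collected.\<close>

lemma sum_shift_le:
  assumes "i \<in> I"
  shows "(\<Sum>l | l \<le> M \<and> l + a \<noteq> m. x i (l + a)) \<le> 1 - x i m"
proof -
  have "(\<Sum>l | l \<le> M \<and> l + a \<noteq> m. x i (l + a)) = (\<Sum>n\<in>(\<lambda>l. l + a) ` {l. l \<le> M \<and> l + a \<noteq> m}. x i n)"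
    by (subst sum.reindex) (auto simp: inj_on_def)
  also have "\<dots> = (\<Sum>n\<in>(\<lambda>l. l + a) ` {l. l \<le> M \<and> l + a \<noteq> m} \<inter> {..M}. x i n)"
    using x_beyond[OF assms] by (intro sum.mono_neutral_right) (fastforce simp: not_le[symmetric])+
  also have "\<dots> \<le> (\<Sum>n\<in>{..M} - {m}. x i n)"
    by (rule sum_mono2) (use assms x_nonneg in auto)
  also have "\<dots> = 1 - x i m"
    using x_sum[OF assms] x_beyond[OF assms, of m] by (cases "m \<le> M") (auto simp: sum_diff1)
  finally show ?thesis .
qed

text \<open>Away from \<open>m\<close> every proportion is at most \<open>Y\<close>. After AM-GM,
  one factor of each power \<open>card I * r\<close> is kept and sums over \<open>l\<close> to at
  most \<open>Y\<close>; the remaining power \<open>card I * r - 1\<close> is bounded by that of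
  \<open>Y\<close>. For \<open>card I * r > 1\<close> the result is of smaller order than
  \<open>Y\<close>, hence negligible for small \<open>Y\<close>.\<close>

lemma sum_weight_avoiding_le:
  assumes Y: "\<And>i. i \<in> I \<Longrightarrow> 1 - x i m \<le> Y"
  shows "(\<Sum>l | l \<le> M \<and> (\<forall>i\<in>I. l + d i \<noteq> m). weight l d)
           \<le> \<theta> ^ (\<Sum>i\<in>I. d i) * Y powr (card I * r)"
proof -
  define L where "L = {l. l \<le> M \<and> (\<forall>i\<in>I. l + d i \<noteq> m)}"
  define \<kappa> where "\<kappa> = card I * r - 1"
  have \<kappa>: "\<kappa> \<ge> 0" using kr_ge_1 by (simp add: \<kappa>_def)
  obtain i0 where i0: "i0 \<in> I" using I_nonempty by auto
  have Y0: "Y \<ge> 0" using Y[OF i0] x_le_1[OF i0, of m] by simp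
  have pt: "x i n powr (card I * r) \<le> Y powr \<kappa> * x i n" if "i \<in> I" "n \<noteq> m" for i n
  proof (cases "x i n = 0")
    case False
    then have pos: "x i n > 0" using x_nonneg[OF that(1), of n] by simp
    have "x i n \<le> Y" using x_off_le[OF that] Y[OF that(1)] by simp
    have "x i n powr (card I * r) = x i n powr \<kappa> * x i n"
      using powr_add[of "x i n" \<kappa> 1] pos by (simp add: \<kappa>_def)
    also have "\<dots> \<le> Y powr \<kappa> * x i n"
      using pos \<kappa> \<open>x i n \<le> Y\<close> by (intro mult_right_mono powr_mono2) auto
    finally show ?thesis .
  qed simp
  have "(\<Sum>l\<in>L. \<Prod>i\<in>I. x i (l + d i) powr r)
          \<le> (\<Sum>l\<in>L. (\<Sum>i\<in>I. x i (l + d i) powr (card I * r)) / card I)"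
    by (rule sum_mono, rule prod_powr_le_mean) (auto simp: finite_I I_nonempty x_nonneg)
  also have "\<dots> \<le> (\<Sum>l\<in>L. (\<Sum>i\<in>I. Y powr \<kappa> * x i (l + d i)) / card I)"
    by (intro sum_mono divide_right_mono pt) (auto simp: L_def)
  also have "\<dots> = Y powr \<kappa> / card I * (\<Sum>i\<in>I. \<Sum>l\<in>L. x i (l + d i))"
    by (subst sum.swap) (simp add: sum_distrib_left sum_divide_distrib)
  also have "\<dots> \<le> Y powr \<kappa> / card I * (\<Sum>i\<in>I. Y)"
  proof (intro mult_left_mono sum_mono)
    fix i assume i: "i \<in> I"
    have "(\<Sum>l\<in>L. x i (l + d i)) \<le> (\<Sum>l | l \<le> M \<and> l + d i \<noteq> m. x i (l + d i))"
      by (rule sum_mono2) (use i x_nonneg in \<open>auto simp: L_def\<close>)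
    also have "\<dots> \<le> Y" using sum_shift_le[OF i] Y[OF i] by (meson order_trans)
    finally show "(\<Sum>l\<in>L. x i (l + d i)) \<le> Y" .
  qed auto
  also have "\<dots> = Y powr \<kappa> * Y" using card_pos by simp
  also have "\<dots> = Y powr (card I * r)"
    using Y0 powr_add[of Y \<kappa> 1] by (cases "Y = 0") (auto simp: \<kappa>_def)
  finally show ?thesis
    using \<theta>_pos by (simp add: weight_def L_def sum_distrib_left[symmetric])
qed

lemma sum_weight_le:
  assumes "d \<in> shifts"
  shows "(\<Sum>l\<le>M. weight l d) \<le> \<theta> ^ (\<Sum>i\<in>I. d i)"
proof -
  \<comment> \<open>The valuation \<open>2 M + 1\<close> is never attained, so avoiding it is no restriction.\<close>
  have "d i \<le> M" if "i \<in> I" for i using assms that by (auto simp: shifts_def)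
  then have "{l. l \<le> M \<and> (\<forall>i\<in>I. l + d i \<noteq> Suc (2 * M))} = {..M}"
    by (fastforce)
  then show ?thesis
    using sum_weight_avoiding_le[of "Suc (2*M)" 1 d] x_nonneg by simp
qed

lemma sum_shifts_le:
  fixes t :: real
  assumes "0 < t" "t < 1"
  shows "(\<Sum>d\<in>shifts. t ^ (\<Sum>i\<in>I. d i)) \<le> (1 / (1 - t)) ^ card I"
proof -
  have "(\<Sum>d\<in>shifts. t ^ (\<Sum>i\<in>I. d i)) \<le> (\<Sum>d\<in>I \<rightarrow>\<^sub>E {..M}. t ^ (\<Sum>i\<in>I. d i))"
    by (rule sum_mono2) (use assms in \<open>auto simp: shifts_def finite_I finite_PiE\<close>)
  also have "\<dots> = (\<Prod>i\<in>I. \<Sum>j\<le>M. t ^ j)"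
    by (subst prod_sum_PiE) (auto simp: finite_I power_sum)
  also have "\<dots> \<le> (\<Prod>i\<in>I. 1 / (1 - t))"
  proof (intro prod_mono conjI sum_nonneg)
    have "(\<Sum>j\<le>M. t ^ j) = (1 - t ^ Suc M) / (1 - t)"
      using assms by (simp add: sum_gp0)
    also have "\<dots> \<le> 1 / (1 - t)" using assms by (intro divide_right_mono) auto
    finally show "(\<Sum>j\<le>M. t ^ j) \<le> 1 / (1 - t)" .
  qed (use assms in auto)
  finally show ?thesis by simp
qed

text \<open>This bound does not depend on the distribution of the valuations; it is the estimate for
  small primes.\<close>

lemma total_weight_le: "(\<Sum>d\<in>shifts. \<Sum>l\<le>M. weight l d) \<le> (1 / (1 - \<theta>)) ^ card I"
  using sum_mono[of shifts "\<lambda>d. \<Sum>l\<le>M. weight l d" "\<lambda>d. \<theta> ^ (\<Sum>i\<in>I. d i)"] sum_weight_le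
    sum_shifts_le[OF \<theta>_pos \<theta>_less_1] by fastforce

section \<open>Profiles concentrated at one valuation\<close>

lemma prod_le_factor:
  fixes f :: "'i \<Rightarrow> real"
  assumes "j \<in> I" "\<And>i. i \<in> I \<Longrightarrow> 0 \<le> f i" "\<And>i. i \<in> I \<Longrightarrow> f i \<le> 1"
  shows "(\<Prod>i\<in>I. f i) \<le> f j"
proof -
  have "(\<Prod>i\<in>I. f i) = f j * (\<Prod>i\<in>I - {j}. f i)"
    using assms finite_I by (simp add: prod.remove)
  also have "\<dots> \<le> f j * 1"
    using assms by (intro mult_left_mono prod_le_1) auto
  finally show ?thesis by simp
qed

lemma x_powr_le_1: "i \<in> I \<Longrightarrow> x i n powr r \<le> 1"
  using x_nonneg x_le_1 r_pos by (simp add: powr_le1)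

text \<open>The pattern in which all coordinates have the same valuation. The restriction to
  \<open>I\<close> makes it extensional, as membership in \<open>shifts\<close> requires.\<close>

definition unshifted :: "'i \<Rightarrow> nat" where
  "unshifted = (\<lambda>i\<in>I. 0)"

lemma unshifted_in_shifts: "unshifted \<in> shifts"
  using I_nonempty by (auto simp: shifts_def unshifted_def)

lemma sum_unshifted [simp]: "(\<Sum>i\<in>I. unshifted i) = 0"
  by (simp add: unshifted_def)

lemma shifted_pos:
  assumes "d \<in> shifts" "d \<noteq> unshifted"
  obtains i where "i \<in> I" "d i > 0"
  using assms by (force simp: shifts_def unshifted_def PiE_iff extensional_def)

text \<open>One factor \<open>t\<close> is kept as the gain and the others are weakened to 1/2. What
  remains is a geometric weight whose sum over \<open>shifts\<close> is bounded by a
  constant.\<close>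

lemma power_le_half:
  assumes "0 \<le> t" "t \<le> 1 / 2" "n > 0"
  shows "t ^ n \<le> 2 * t * (1 / 2 :: real) ^ n"
proof -
  obtain j where n: "n = Suc j" using assms by (cases n) auto
  have "t * t ^ j \<le> t * (1 / 2) ^ j" using assms by (intro mult_left_mono power_mono) auto
  then show ?thesis by (simp add: n)
qed

lemma sum_shifts_half: "(\<Sum>d\<in>shifts. (1 / 2) ^ (\<Sum>i\<in>I. d i)) \<le> (2::real) ^ card I"
  using sum_shifts_le[of "1/2"] by simp

lemma sum_shifted_le:
  assumes "\<theta> \<le> 1 / 2"
  shows "(\<Sum>d\<in>shifts - {unshifted}. \<theta> ^ (\<Sum>i\<in>I. d i)) \<le> 2 ^ (card I + 1) * \<theta>"
proof -
  have "(\<Sum>d\<in>shifts - {unshifted}. \<theta> ^ (\<Sum>i\<in>I. d i))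
          \<le> (\<Sum>d\<in>shifts - {unshifted}. 2 * \<theta> * (1 / 2) ^ (\<Sum>i\<in>I. d i))"
  proof (rule sum_mono)
    fix d assume d: "d \<in> shifts - {unshifted}"
    then obtain i where "i \<in> I" "d i > 0" by (auto elim: shifted_pos)
    then have "(\<Sum>i\<in>I. d i) > 0" using finite_I by (meson sum_pos2 zero_le)
    then show "\<theta> ^ (\<Sum>i\<in>I. d i) \<le> 2 * \<theta> * (1 / 2) ^ (\<Sum>i\<in>I. d i)"
      using power_le_half assms \<theta>_pos by simp
  qed
  also have "\<dots> \<le> (\<Sum>d\<in>shifts. 2 * \<theta> * (1 / 2) ^ (\<Sum>i\<in>I. d i))"
    using finite_shifts \<theta>_pos by (intro sum_mono2) auto
  also have "\<dots> \<le> 2 * \<theta> * 2 ^ card I"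
    unfolding sum_distrib_left[symmetric] using \<theta>_pos sum_shifts_half by (intro mult_left_mono) auto
  finally show ?thesis by (simp add: mult_ac)
qed

text \<open>If no valuation had proportion at least \<open>1 - \<nu>\<close> in every coordinate,
  each unshifted pattern would contain a factor below \<open>1 - \<nu>\<close> and so lose a fixed
  factor. The shifted patterns add only a multiple of \<open>\<theta>\<close>, so the total weight
  could not exceed 1.\<close>

lemma concentrated:
  assumes "\<theta> \<le> 1 / 2" "0 < \<nu>" "\<nu> < 1"
    and "(1 - \<nu>) powr ((card I * r - 1) / card I) + 2 ^ (card I + 1) * \<theta> \<le> 1"
    and big: "1 < (\<Sum>d\<in>shifts. \<Sum>l\<le>M. weight l d)"
  obtains m where "\<And>i. i \<in> I \<Longrightarrow> 1 - x i m \<le> \<nu>"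
proof -
  have "\<exists>m. \<forall>i\<in>I. 1 - x i m \<le> \<nu>"
  proof (rule ccontr)
    assume "\<not> ?thesis"
    then have ex: "\<exists>i\<in>I. x i m < 1 - \<nu>" for m by (smt (verit, best))
    \<comment> \<open>The exponent is split as \<open>r = a + 1 / card I\<close>. The part
      \<open>1 / card I\<close> is just enough for the sum over \<open>l\<close> to be at most 1 by
      AM-GM; the part \<open>a\<close> carries the saving.\<close>
    define a where "a = (card I * r - 1) / card I"
    have a: "0 \<le> a" "a + 1 / card I = r"
      using kr_ge_1 card_pos by (auto simp: a_def field_simps)
    have pt: "weight l unshifted \<le> (1 - \<nu>) powr a * ((\<Sum>i\<in>I. x i l) / card I)" for l
    proof -
      obtain j where j: "j \<in> I" "x j l < 1 - \<nu>" using ex by blast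
      have "weight l unshifted = (\<Prod>i\<in>I. x i l powr r)"
        unfolding weight_def by (simp add: unshifted_def)
      also have "\<dots> = (\<Prod>i\<in>I. x i l powr a) * (\<Prod>i\<in>I. x i l powr (1 / card I))"
        by (simp add: prod.distrib[symmetric] powr_add[symmetric] a)
      also have "\<dots> \<le> (1 - \<nu>) powr a * ((\<Sum>i\<in>I. x i l) / card I)"
      proof (intro mult_mono)
        have "(\<Prod>i\<in>I. x i l powr a) \<le> x j l powr a"
          using a x_nonneg x_le_1 j by (intro prod_le_factor) (auto simp: powr_le1)
        also have "\<dots> \<le> (1 - \<nu>) powr a" using j x_nonneg a by (intro powr_mono2) auto
        finally show "(\<Prod>i\<in>I. x i l powr a) \<le> (1 - \<nu>) powr a" .
        have "(\<Prod>i\<in>I. x i l powr (1 / card I)) \<le> (\<Sum>i\<in>I. x i l powr (card I * (1 / card I))) / card I"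
          by (rule prod_powr_le_mean) (auto simp: finite_I I_nonempty x_nonneg)
        then show "(\<Prod>i\<in>I. x i l powr (1 / card I)) \<le> (\<Sum>i\<in>I. x i l) / card I"
          using card_pos x_nonneg by simp
      qed (auto intro!: prod_nonneg)
      finally show ?thesis .
    qed
    have "(\<Sum>l\<le>M. weight l unshifted) \<le> (\<Sum>l\<le>M. (1 - \<nu>) powr a * ((\<Sum>i\<in>I. x i l) / card I))"
      by (intro sum_mono pt)
    also have "\<dots> = (1 - \<nu>) powr a * ((\<Sum>i\<in>I. \<Sum>l\<le>M. x i l) / card I)"
      by (subst sum.swap) (simp add: sum_distrib_left sum_divide_distrib)
    also have "\<dots> = (1 - \<nu>) powr a" using card_pos x_sum by simp
    finally have 0: "(\<Sum>l\<le>M. weight l unshifted) \<le> (1 - \<nu>) powr a" .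
    have "(\<Sum>d\<in>shifts - {unshifted}. \<Sum>l\<le>M. weight l d)
            \<le> (\<Sum>d\<in>shifts - {unshifted}. \<theta> ^ (\<Sum>i\<in>I. d i))"
      by (intro sum_mono sum_weight_le) auto
    also have "\<dots> \<le> 2 ^ (card I + 1) * \<theta>" by (rule sum_shifted_le[OF assms(1)])
    finally have "(\<Sum>d\<in>shifts. \<Sum>l\<le>M. weight l d) \<le> (1 - \<nu>) powr a + 2 ^ (card I + 1) * \<theta>"
      using 0 by (subst sum.remove[OF finite_shifts unshifted_in_shifts]) auto
    with assms(4) big show False by (simp add: a_def)
  qed
  then show ?thesis using that by blast
qed

text \<open>All factors but the one at \<open>j\<close> are at most 1, and the concave function
  \<open>t powr r\<close> lies below its tangent at 1. The main term thus loses an amount linear in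
  \<open>1 - x j m\<close>.\<close>

lemma unshifted_weight_le:
  assumes "j \<in> I"
  shows "weight m unshifted \<le> 1 - r * (1 - x j m)"
proof -
  have "weight m unshifted = (\<Prod>i\<in>I. x i m powr r)"
    unfolding weight_def by (simp add: unshifted_def)
  also have "\<dots> \<le> x j m powr r"
    using assms x_powr_le_1 by (intro prod_le_factor) auto
  also have "\<dots> \<le> 1 - r * (1 - x j m)"
  proof (cases "x j m = 0")
    case False
    then have "x j m powr r * 1 powr (1 - r) \<le> r * x j m + (1 - r) * 1"
      using r_pos r_le_1 x_nonneg[OF assms, of m] by (intro Youngs_inequality_0) auto
    then show ?thesis by (simp add: algebra_simps)
  qed (use r_le_1 in auto)
  finally show ?thesis .
qed

text \<open>Each coordinate can sit at \<open>m\<close> for only one \<open>l\<close>, namely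
  \<open>m - d i\<close>.\<close>

lemma card_touching: "card {l. l \<le> M \<and> (\<exists>i\<in>I. l + d i = m)} \<le> card I"
proof -
  have "{l. l \<le> M \<and> (\<exists>i\<in>I. l + d i = m)} \<subseteq> (\<lambda>i. m - d i) ` I" by force
  then show ?thesis using finite_I by (meson card_image_le card_mono finite_imageI order_trans)
qed

lemma shifted_weight_le:
  assumes Y: "\<And>i. i \<in> I \<Longrightarrow> 1 - x i m \<le> Y" and j: "j \<in> I" "l + d j \<noteq> m"
  shows "weight l d \<le> \<theta> ^ (\<Sum>i\<in>I. d i) * Y powr r"
proof -
  have "(\<Prod>i\<in>I. x i (l + d i) powr r) \<le> x j (l + d j) powr r"
    using j x_powr_le_1 by (intro prod_le_factor) auto
  also have "\<dots> \<le> Y powr r"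
    using j x_off_le[OF j] Y[OF j(1)] x_nonneg r_pos by (intro powr_mono2) fastforce+
  finally show ?thesis unfolding weight_def using \<theta>_pos by (intro mult_left_mono) auto
qed

text \<open>Only the part touching \<open>m\<close> keeps the condition \<open>P\<close>. It is used
  with \<open>P\<close> trivial for the total weight and with \<open>l \<noteq> m\<close> for the
  off-centre weight.\<close>

lemma sum_split_touching:
  "(\<Sum>l | l \<le> M \<and> P l. weight l d) \<le>
     (\<Sum>l | l \<le> M \<and> (\<forall>i\<in>I. l + d i \<noteq> m). weight l d)
     + (\<Sum>l | l \<le> M \<and> (\<exists>i\<in>I. l + d i = m) \<and> P l. weight l d)"
proof -
  have "(\<Sum>l | l \<le> M \<and> P l. weight l d)
     \<le> sum (\<lambda>l. weight l d) ({l. l \<le> M \<and> (\<forall>i\<in>I. l + d i \<noteq> m)}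
          \<union> {l. l \<le> M \<and> (\<exists>i\<in>I. l + d i = m) \<and> P l})"
    by (rule sum_mono2) (auto simp: weight_nonneg)
  also have "\<dots> = (\<Sum>l | l \<le> M \<and> (\<forall>i\<in>I. l + d i \<noteq> m). weight l d)
     + (\<Sum>l | l \<le> M \<and> (\<exists>i\<in>I. l + d i = m) \<and> P l. weight l d)"
    by (rule sum.union_disjoint) auto
  finally show ?thesis .
qed

lemma sum_avoiding_le:
  assumes "\<theta> \<le> 1 / 2" and Y: "\<And>i. i \<in> I \<Longrightarrow> 1 - x i m \<le> Y"
  shows "(\<Sum>d\<in>shifts. \<Sum>l | l \<le> M \<and> (\<forall>i\<in>I. l + d i \<noteq> m). weight l d)
           \<le> 2 ^ card I * Y powr (card I * r)"
proof -
  have "(\<Sum>d\<in>shifts. \<Sum>l | l \<le> M \<and> (\<forall>i\<in>I. l + d i \<noteq> m). weight l d)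
     \<le> (\<Sum>d\<in>shifts. (1 / 2) ^ (\<Sum>i\<in>I. d i) * Y powr (card I * r))"
  proof (rule sum_mono)
    fix d
    have "\<theta> ^ (\<Sum>i\<in>I. d i) * Y powr (card I * r) \<le> (1 / 2) ^ (\<Sum>i\<in>I. d i) * Y powr (card I * r)"
      using assms(1) \<theta>_pos by (intro mult_right_mono power_mono) auto
    then show "(\<Sum>l | l \<le> M \<and> (\<forall>i\<in>I. l + d i \<noteq> m). weight l d)
       \<le> (1 / 2) ^ (\<Sum>i\<in>I. d i) * Y powr (card I * r)"
      using sum_weight_avoiding_le[OF Y, of d] by simp
  qed
  also have "\<dots> \<le> 2 ^ card I * Y powr (card I * r)"
    unfolding sum_distrib_right[symmetric] using sum_shifts_half by (intro mult_right_mono) auto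
  finally show ?thesis .
qed

text \<open>The three terms after 1 have separate sources. The unshifted pattern at \<open>m\<close>
  loses \<open>r * Y\<close>; patterns avoiding \<open>m\<close> give the power
  \<open>card I * r\<close>. A shifted pattern touching \<open>m\<close> has a zero and a positive
  entry of \<open>d\<close>, so some coordinate is off \<open>m\<close>, which yields
  \<open>Y powr r\<close> besides the powers of \<open>\<theta>\<close>. The index \<open>j\<close>
  ensures that the loss involves the same \<open>Y\<close> as the errors.\<close>

lemma total_weight_concentrated_le:
  assumes "\<theta> \<le> 1 / 2" and Y: "\<And>i. i \<in> I \<Longrightarrow> 1 - x i m \<le> Y" and j: "j \<in> I" "1 - x j m = Y"
  shows "(\<Sum>d\<in>shifts. \<Sum>l\<le>M. weight l d)
           \<le> 1 - r * Y + 2 ^ card I * Y powr (card I * r) + card I * 2 ^ (card I + 1) * \<theta> * Y powr r"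
proof -
  let ?T = "\<lambda>d. \<Sum>l | l \<le> M \<and> (\<exists>i\<in>I. l + d i = m) \<and> True. weight l d"
  have shifted: "?T d \<le> card I * Y powr r * \<theta> ^ (\<Sum>i\<in>I. d i)" if d: "d \<in> shifts - {unshifted}" for d
  proof -
    obtain i1 where i1: "i1 \<in> I" "d i1 = 0" using d by (auto simp: shifts_def)
    obtain i2 where i2: "i2 \<in> I" "d i2 > 0" using d by (auto elim: shifted_pos)
    have "?T d \<le> (\<Sum>l | l \<le> M \<and> (\<exists>i\<in>I. l + d i = m) \<and> True. \<theta> ^ (\<Sum>i\<in>I. d i) * Y powr r)"
    proof (rule sum_mono)
      fix l
      have "l + d i1 \<noteq> m \<or> l + d i2 \<noteq> m" using i1 i2 by auto
      then show "weight l d \<le> \<theta> ^ (\<Sum>i\<in>I. d i) * Y powr r"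
        using shifted_weight_le[OF Y] i1 i2 by blast
    qed
    also have "\<dots> \<le> card I * (\<theta> ^ (\<Sum>i\<in>I. d i) * Y powr r)"
      using card_touching[of d m] \<theta>_pos by (auto intro!: mult_right_mono)
    finally show ?thesis by (simp add: mult_ac)
  qed
  have "?T unshifted \<le> 1 - r * Y"
  proof (cases "m \<le> M")
    case True
    have "{l. l \<le> M \<and> (\<exists>i\<in>I. l + unshifted i = m) \<and> True} = {m}"
      using True I_nonempty by (auto simp: unshifted_def)
    then show ?thesis using unshifted_weight_le[OF j(1), of m] j by simp
  next
    case False
    then have empty: "{l. l \<le> M \<and> (\<exists>i\<in>I. l + unshifted i = m) \<and> True} = {}"
      by (auto simp: unshifted_def)
    \<comment> \<open>For \<open>m > M\<close> the sum is empty, so only nonnegativity of the bound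
      is left to check.\<close>
    have "r * Y \<le> 1 * 1"
      using j r_pos r_le_1 x_nonneg[OF j(1), of m] x_le_1[OF j(1), of m] by (intro mult_mono) auto
    then show ?thesis unfolding empty by simp
  qed
  moreover have "(\<Sum>d\<in>shifts - {unshifted}. ?T d) \<le> card I * Y powr r * (2 ^ (card I + 1) * \<theta>)"
  proof -
    have "(\<Sum>d\<in>shifts - {unshifted}. ?T d)
       \<le> (\<Sum>d\<in>shifts - {unshifted}. card I * Y powr r * \<theta> ^ (\<Sum>i\<in>I. d i))"
      by (intro sum_mono shifted)
    also have "\<dots> \<le> card I * Y powr r * (2 ^ (card I + 1) * \<theta>)"
      unfolding sum_distrib_left[symmetric] using sum_shifted_le[OF assms(1)]
      by (intro mult_left_mono) auto
    finally show ?thesis .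
  qed
  ultimately have "(\<Sum>d\<in>shifts. ?T d) \<le> 1 - r * Y + card I * 2 ^ (card I + 1) * \<theta> * Y powr r"
    by (subst sum.remove[OF finite_shifts unshifted_in_shifts]) (simp add: mult_ac)
  moreover have "(\<Sum>d\<in>shifts. \<Sum>l\<le>M. weight l d)
     \<le> (\<Sum>d\<in>shifts. (\<Sum>l | l \<le> M \<and> (\<forall>i\<in>I. l + d i \<noteq> m). weight l d) + ?T d)"
    using sum_split_touching[where P = "\<lambda>_. True"] by (intro sum_mono) (simp add: atMost_def)
  ultimately show ?thesis
    using sum_avoiding_le[OF assms(1) Y] by (simp add: sum.distrib)
qed

text \<open>
  If \<open>l + d i0 = m\<close> with \<open>l \<noteq> m\<close>, then \<open>d i0 > 0\<close> yields a factor \<open>\<theta>\<close>, while every other coordinate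
  yields a factor \<open>\<theta>\<close> (if \<open>d i > 0\<close>) or \<open>Y powr r\<close> (if \<open>d i = 0\<close>).
\<close>
lemma off_centre_weight_le:
  assumes "\<theta> \<le> 1 / 2" and Y: "\<And>i. i \<in> I \<Longrightarrow> 1 - x i m \<le> Y"
    and \<rho>: "Y powr r \<le> \<rho>" "\<theta> \<le> \<rho>"
  shows "(\<Sum>d\<in>shifts. \<Sum>l | l \<le> M \<and> l \<noteq> m. weight l d)
           \<le> 2 ^ card I * Y powr (card I * r) + card I * 4 ^ card I * \<theta> * \<rho> ^ (card I - 1)"
proof -
  let ?T = "\<lambda>d. \<Sum>l | l \<le> M \<and> (\<exists>i\<in>I. l + d i = m) \<and> l \<noteq> m. weight l d"
  have \<rho>_pos: "\<rho> > 0" using \<rho> \<theta>_pos by simp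
  \<comment> \<open>Each coordinate is allowed the factor 2 of \<open>power_le_half\<close>; the
    coordinate \<open>i0\<close> gains \<open>\<theta>\<close>, and each of the other
    \<open>card I - 1\<close> gains \<open>\<rho>\<close>, which dominates both
    \<open>\<theta>\<close> and \<open>Y powr r\<close>.\<close>
  define c where "c = 2 ^ card I * \<theta> * \<rho> ^ (card I - 1)"
  have c: "c \<ge> 0" using \<rho>_pos \<theta>_pos by (simp add: c_def)
  have pt: "weight l d \<le> c * (1 / 2) ^ (\<Sum>i\<in>I. d i)"
    if d: "d \<in> shifts" and l: "l \<noteq> m" and i0: "i0 \<in> I" "l + d i0 = m" for d l i0
  proof -
    have c_prod: "c * (1 / 2) ^ (\<Sum>i\<in>I. d i)
       = (2 * \<theta> * (1 / 2) ^ d i0) * (\<Prod>i\<in>I - {i0}. 2 * \<rho> * (1 / 2) ^ d i)"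
    proof -
      obtain k' where k': "card I = Suc k'" using card_pos by (cases "card I") auto
      have "(1 / 2 :: real) ^ (\<Sum>i\<in>I. d i) = (1 / 2) ^ d i0 * (\<Prod>i\<in>I - {i0}. (1 / 2) ^ d i)"
        using i0 finite_I by (simp add: power_sum prod.remove)
      moreover have "card (I - {i0}) = k'" using k' i0 finite_I by simp
      ultimately show ?thesis
        by (simp add: c_def k' prod.distrib power_mult_distrib)
    qed
    have "weight l d = (\<Prod>i\<in>I. \<theta> ^ d i * x i (l + d i) powr r)"
      unfolding weight_def by (simp add: prod.distrib power_sum)
    also have "\<dots> = (\<theta> ^ d i0 * x i0 (l + d i0) powr r) * (\<Prod>i\<in>I - {i0}. \<theta> ^ d i * x i (l + d i) powr r)"
      using i0 finite_I by (simp add: prod.remove)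
    also have "\<dots> \<le> (2 * \<theta> * (1 / 2) ^ d i0) * (\<Prod>i\<in>I - {i0}. 2 * \<rho> * (1 / 2) ^ d i)"
    proof (rule mult_mono)
      have "d i0 > 0" using l i0 by (cases "d i0") auto
      then have "\<theta> ^ d i0 * x i0 (l + d i0) powr r \<le> 2 * \<theta> * (1 / 2) ^ d i0 * 1"
        using \<theta>_pos assms(1) x_powr_le_1[OF i0(1)] by (intro mult_mono power_le_half) auto
      then show "\<theta> ^ d i0 * x i0 (l + d i0) powr r \<le> 2 * \<theta> * (1 / 2) ^ d i0" by simp
      have "\<theta> ^ d i * x i (l + d i) powr r \<le> 2 * \<rho> * (1 / 2) ^ d i" if i: "i \<in> I - {i0}" for i
      proof (cases "d i = 0")
        case True
        have "x i l powr r \<le> Y powr r"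
          using i x_off_le[of i l m] l Y[of i] x_nonneg r_pos by (intro powr_mono2) fastforce+
        then show ?thesis using True \<rho> \<rho>_pos by simp
      next
        case False
        have "\<theta> ^ d i * x i (l + d i) powr r \<le> 2 * \<theta> * (1 / 2) ^ d i * 1"
          using False \<theta>_pos assms(1) x_powr_le_1 i by (intro mult_mono power_le_half) auto
        also have "\<dots> \<le> 2 * \<rho> * (1 / 2) ^ d i" using \<rho> by (simp add: divide_right_mono)
        finally show ?thesis .
      qed
      then show "(\<Prod>i\<in>I - {i0}. \<theta> ^ d i * x i (l + d i) powr r) \<le> (\<Prod>i\<in>I - {i0}. 2 * \<rho> * (1 / 2) ^ d i)"
        using \<theta>_pos by (intro prod_mono) auto
    qed (use \<theta>_pos in \<open>auto intro!: prod_nonneg\<close>)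
    finally show ?thesis using c_prod by simp
  qed
  have T: "?T d \<le> card I * c * (1 / 2) ^ (\<Sum>i\<in>I. d i)" if d: "d \<in> shifts" for d
  proof -
    have "?T d \<le> (\<Sum>l | l \<le> M \<and> (\<exists>i\<in>I. l + d i = m) \<and> l \<noteq> m. c * (1 / 2) ^ (\<Sum>i\<in>I. d i))"
      by (rule sum_mono) (use pt[OF d] in auto)
    also have "\<dots> = card {l. l \<le> M \<and> (\<exists>i\<in>I. l + d i = m) \<and> l \<noteq> m} * (c * (1 / 2) ^ (\<Sum>i\<in>I. d i))"
      by simp
    also have "\<dots> \<le> card I * (c * (1 / 2) ^ (\<Sum>i\<in>I. d i))"
    proof (intro mult_right_mono)
      have "card {l. l \<le> M \<and> (\<exists>i\<in>I. l + d i = m) \<and> l \<noteq> m} \<le> card {l. l \<le> M \<and> (\<exists>i\<in>I. l + d i = m)}"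
        by (intro card_mono) auto
      then show "real (card {l. l \<le> M \<and> (\<exists>i\<in>I. l + d i = m) \<and> l \<noteq> m}) \<le> real (card I)"
        using card_touching[of d m] by linarith
    qed (use c in auto)
    finally show ?thesis by (simp add: mult_ac)
  qed
  have "(\<Sum>d\<in>shifts. ?T d) \<le> (\<Sum>d\<in>shifts. card I * c * (1 / 2) ^ (\<Sum>i\<in>I. d i))"
    by (intro sum_mono T)
  also have "\<dots> \<le> card I * c * 2 ^ card I"
    unfolding sum_distrib_left[symmetric] using sum_shifts_half c by (intro mult_left_mono) auto
  also have "\<dots> = card I * 4 ^ card I * \<theta> * \<rho> ^ (card I - 1)"
    using power_mult_distrib[of "2::real" 2 "card I"] by (simp add: c_def)
  finally have "(\<Sum>d\<in>shifts. ?T d) \<le> card I * 4 ^ card I * \<theta> * \<rho> ^ (card I - 1)" .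
  moreover have "(\<Sum>d\<in>shifts. \<Sum>l | l \<le> M \<and> l \<noteq> m. weight l d)
     \<le> (\<Sum>d\<in>shifts. (\<Sum>l | l \<le> M \<and> (\<forall>i\<in>I. l + d i \<noteq> m). weight l d) + ?T d)"
    by (intro sum_mono sum_split_touching)
  ultimately show ?thesis
    using sum_avoiding_le[OF assms(1) Y] by (simp add: sum.distrib)
qed

end

subsection \<open>Concentration at large primes\<close>

text \<open>For large \<open>p\<close>, total weight above 1 forces concentration at some
  \<open>m\<close>. Comparing the linear loss \<open>r * Y\<close> with the error terms then gives
  \<open>Y powr \<mu>\<close> at most a constant times \<open>p powr - \<mu>\<close>, that is,
  \<open>Y\<close> of order at most \<open>1 / p\<close>. Inserted into the off-centre bound this
  yields the exponents \<open>k * r\<close> and \<open>\<mu> + (k - 1) * r\<close>, both above 1.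
  The profile is quantified inside the conclusion so that the constants are uniform in it.\<close>

lemma off_centre_threshold:
  fixes k :: nat and \<mu> r :: real
  assumes sum1: "\<mu> + r = 1" and r_pos: "0 < r" and "r \<le> \<mu>"
    and kr: "1 < k * r" and kr': "1 < \<mu> + (k - 1) * r"
  obtains P c \<eta> :: real where "1 \<le> P" "0 \<le> c" "0 < \<eta>"
    "\<forall>(I :: 'i set) M x p. P \<le> p \<and> card I = k \<and> profile I M x r (p powr - \<mu>) \<and>
       1 < (\<Sum>d\<in>profile.shifts I M. \<Sum>l\<le>M. profile.weight I x r (p powr - \<mu>) l d) \<longrightarrow>
       (\<exists>m. (\<Sum>d\<in>profile.shifts I M. \<Sum>l | l \<le> M \<and> l \<noteq> m. profile.weight I x r (p powr - \<mu>) l d)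
             \<le> c * p powr (- 1 - \<eta>))"
proof -
  have k1: "k \<ge> 1" using kr by (cases k) auto
  have \<mu>_pos: "\<mu> > 0" and r1: "r \<le> 1" using assms by auto
  define \<kappa> where "\<kappa> = k * r - 1"
  have \<kappa>: "\<kappa> > 0" using kr by (simp add: \<kappa>_def)
  \<comment> \<open>Chosen so that \<open>2 ^ k * \<nu> powr \<kappa> = r / 2\<close>: for
    \<open>Y \<le> \<nu>\<close> the superlinear term absorbs at most half of the loss
    \<open>r * Y\<close>.\<close>
  define \<nu> where "\<nu> = (r / 2 ^ (k + 1)) powr (1 / \<kappa>)"
  have base: "0 < r / 2 ^ (k + 1)" "r / 2 ^ (k + 1) < 1"
  proof -
    have "(1::real) < 2 ^ (k + 1)" by (rule one_less_power) auto
    then show "r / 2 ^ (k + 1) < 1" using r1 by (simp add: divide_less_eq)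
  qed (use r_pos in simp)
  have \<nu>: "0 < \<nu>" "\<nu> < 1"
    using base \<kappa> by (auto simp: \<nu>_def powr01_less_one)
  have \<nu>\<kappa>: "2 ^ k * \<nu> powr \<kappa> = r / 2"
    using base \<kappa> r_pos by (simp add: \<nu>_def powr_powr)
  define a where "a = \<kappa> / k"
  have a: "a > 0" using \<kappa> k1 by (simp add: a_def)
  \<comment> \<open>The second entry is the numerical hypothesis of \<open>concentrated\<close>
    solved for \<open>\<theta>\<close>; \<open>P\<close> below is the size of \<open>p\<close> at
    which \<open>p powr - \<mu>\<close> has dropped to \<open>\<theta>0\<close>.\<close>
  define \<theta>0 where "\<theta>0 = min (1 / 2) ((1 - (1 - \<nu>) powr a) / 2 ^ (k + 1))"
  have \<theta>0: "\<theta>0 > 0" using \<nu> a by (simp add: \<theta>0_def powr01_less_one)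
  define P where "P = max 1 (\<theta>0 powr (- 1 / \<mu>))"
  \<comment> \<open>With half of the loss left,
    \<open>r / 2 * Y < k * 2 ^ (k + 1) * \<theta> * Y powr r\<close>, which reads
    \<open>Y < B * \<theta> * Y powr r\<close>. Cancelling \<open>Y powr r\<close> and taking the
    root of order \<open>\<mu>\<close> gives \<open>Y \<le> H / p\<close>.\<close>
  define B where "B = k * 2 ^ (k + 2) / r"
  have B: "B \<ge> 1"
  proof -
    have "r \<le> 1 * 1" using r1 by simp
    also have "\<dots> \<le> real k * 2 ^ (k + 2)" using k1 by (intro mult_mono) (auto simp del: power_Suc)
    finally show ?thesis using r_pos by (simp add: B_def)
  qed
  define H where "H = B powr (1 / \<mu>)"
  have H: "H \<ge> 1" using B \<mu>_pos by (simp add: H_def ge_one_powr_ge_zero)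
  define c where "c = 2 ^ k * H powr (k * r) + k * 4 ^ k * (H powr r) ^ (k - 1)"
  define \<eta> where "\<eta> = min (k * r - 1) (\<mu> + (k - 1) * r - 1)"
  show thesis
  proof (rule that[of P c \<eta>]; (intro allI impI)?; (elim conjE)?)
    show "1 \<le> P" "0 \<le> c" "0 < \<eta>" using H kr kr' by (auto simp: P_def c_def \<eta>_def)
    fix I :: "'i set" and M x p
    define \<theta> where "\<theta> = p powr - \<mu>"
    assume p: "P \<le> p" and k: "card I = k" and "profile I M x r (p powr - \<mu>)"
      and big': "1 < (\<Sum>d\<in>profile.shifts I M. \<Sum>l\<le>M. profile.weight I x r (p powr - \<mu>) l d)"
    then interpret profile I M x r \<theta> by (simp add: \<theta>_def)
    have big: "1 < (\<Sum>d\<in>shifts. \<Sum>l\<le>M. weight l d)" using big' by (simp add: \<theta>_def)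
    have p1: "p \<ge> 1" using p by (simp add: P_def)
    have "\<theta> \<le> (\<theta>0 powr (- 1 / \<mu>)) powr - \<mu>"
      unfolding \<theta>_def using p \<theta>0 \<mu>_pos by (intro powr_mono2') (auto simp: P_def)
    then have \<theta>_le: "\<theta> \<le> \<theta>0" using \<theta>0 \<mu>_pos by (simp add: powr_powr)
    then have half: "\<theta> \<le> 1 / 2" by (simp add: \<theta>0_def)
    have "\<theta> \<le> (1 - (1 - \<nu>) powr a) / 2 ^ (k + 1)" using \<theta>_le by (simp add: \<theta>0_def)
    then have "(1 - \<nu>) powr a + 2 ^ (k + 1) * \<theta> \<le> 1" by (simp add: field_simps)
    then obtain m where m: "\<And>i. i \<in> I \<Longrightarrow> 1 - x i m \<le> \<nu>"
      using concentrated[OF half \<nu>] big by (auto simp: k a_def \<kappa>_def)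
    define Y where "Y = Max ((\<lambda>i. 1 - x i m) ` I)"
    have Y: "1 - x i m \<le> Y" if "i \<in> I" for i
      using that finite_I by (simp add: Y_def)
    have "Y \<in> (\<lambda>i. 1 - x i m) ` I"
      unfolding Y_def using finite_I I_nonempty by (intro Max_in) auto
    then obtain j where j: "j \<in> I" "1 - x j m = Y" by auto
    have Y_bounds: "0 \<le> Y" "Y \<le> \<nu>" using j m x_le_1[of j m] by auto
    have total: "1 < 1 - r * Y + 2 ^ k * Y powr (k * r) + k * 2 ^ (k + 1) * \<theta> * Y powr r"
      using total_weight_concentrated_le[OF half Y j] big by (simp add: k)
    have Y_le: "Y \<le> H / p"
    proof (cases "Y = 0")
      case False
      then have Y_pos: "Y > 0" using Y_bounds by simp
      have "2 ^ k * Y powr (k * r) = 2 ^ k * Y powr \<kappa> * Y"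
        using powr_add[of Y \<kappa> 1] Y_pos by (simp add: \<kappa>_def)
      also have "\<dots> \<le> 2 ^ k * \<nu> powr \<kappa> * Y"
        using Y_bounds \<kappa> by (intro mult_right_mono mult_left_mono powr_mono2) auto
      finally have "2 ^ k * Y powr (k * r) \<le> r / 2 * Y" unfolding \<nu>\<kappa> .
      with total have "r / 2 * Y < k * 2 ^ (k + 1) * \<theta> * Y powr r" by linarith
      then have "Y < B * \<theta> * Y powr r" using r_pos by (simp add: B_def field_simps)
      then have "Y powr \<mu> * Y powr r < B * \<theta> * Y powr r"
        using Y_pos by (simp add: powr_add[symmetric] sum1)
      then have "Y powr \<mu> \<le> B * \<theta>" using Y_pos by simp
      then have "(Y powr \<mu>) powr (1 / \<mu>) \<le> (B * \<theta>) powr (1 / \<mu>)"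
        using \<mu>_pos by (intro powr_mono2) auto
      also have "(B * \<theta>) powr (1 / \<mu>) = H * p powr - 1"
        unfolding \<theta>_def H_def powr_mult powr_powr using \<mu>_pos by simp
      also have "p powr - 1 = 1 / p" using p1 by (simp add: powr_minus_divide)
      finally show ?thesis using \<mu>_pos Y_pos by (simp add: powr_powr)
    qed (use H p1 in auto)
    define \<rho> where "\<rho> = H powr r * p powr - r"
    have "Y powr r \<le> (H / p) powr r" using Y_le Y_bounds r_pos by (intro powr_mono2) auto
    also have "\<dots> = \<rho>" using H p1 by (simp add: \<rho>_def powr_divide powr_minus_divide)
    finally have \<rho>1: "Y powr r \<le> \<rho>" .
    \<comment> \<open>Here \<open>r \<le> \<mu>\<close> enters: the gain from a positive shift is at
      least as good as that from a coordinate off \<open>m\<close>.\<close>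
    have "\<theta> \<le> 1 * p powr - r" using assms(3) p1 by (simp add: \<theta>_def powr_mono)
    also have "\<dots> \<le> \<rho>"
      unfolding \<rho>_def using H r_pos by (intro mult_right_mono) (auto simp: ge_one_powr_ge_zero)
    finally have \<rho>2: "\<theta> \<le> \<rho>" .
    have e1: "Y powr (k * r) \<le> H powr (k * r) * p powr (- 1 - \<eta>)"
    proof -
      have "Y powr (k * r) \<le> (H / p) powr (k * r)"
        using Y_le Y_bounds r_pos by (intro powr_mono2) auto
      also have "\<dots> = H powr (k * r) * p powr - (k * r)"
        using H p1 by (simp add: powr_divide powr_minus_divide)
      also have "\<dots> \<le> H powr (k * r) * p powr (- 1 - \<eta>)"
        using p1 by (intro mult_left_mono powr_mono) (auto simp: \<eta>_def)
      finally show ?thesis .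
    qed
    have e2: "\<theta> * \<rho> ^ (k - 1) \<le> (H powr r) ^ (k - 1) * p powr (- 1 - \<eta>)"
    proof -
      have "\<theta> * \<rho> ^ (k - 1) = (H powr r) ^ (k - 1) * (p powr - \<mu> * (p powr - r) ^ (k - 1))"
        by (simp add: \<theta>_def \<rho>_def power_mult_distrib mult_ac)
      also have "(p powr - r) ^ (k - 1) = p powr (- r * real (k - 1))"
        using p1 by (simp add: powr_powr powr_realpow[symmetric])
      also have "p powr - \<mu> * p powr (- r * real (k - 1)) = p powr (- \<mu> + - r * real (k - 1))"
        by (rule powr_add[symmetric])
      also have "(H powr r) ^ (k - 1) * p powr (- \<mu> + - r * real (k - 1))
          \<le> (H powr r) ^ (k - 1) * p powr (- 1 - \<eta>)"
        using p1 k1 by (intro mult_left_mono powr_mono) (auto simp: \<eta>_def mult_ac)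
      finally show ?thesis .
    qed
    have "(\<Sum>d\<in>shifts. \<Sum>l | l \<le> M \<and> l \<noteq> m. weight l d)
        \<le> 2 ^ k * Y powr (k * r) + k * 4 ^ k * (\<theta> * \<rho> ^ (k - 1))"
      using off_centre_weight_le[OF half Y \<rho>1 \<rho>2] by (simp add: k mult_ac)
    also have "\<dots> \<le> 2 ^ k * (H powr (k * r) * p powr (- 1 - \<eta>))
        + k * 4 ^ k * ((H powr r) ^ (k - 1) * p powr (- 1 - \<eta>))"
      by (intro add_mono mult_left_mono e1 e2) auto
    also have "\<dots> = c * p powr (- 1 - \<eta>)" by (simp add: c_def algebra_simps)
    finally show "\<exists>m. (\<Sum>d\<in>profile.shifts I M. \<Sum>l | l \<le> M \<and> l \<noteq> m.
        profile.weight I x r (p powr - \<mu>) l d) \<le> c * p powr (- 1 - \<eta>)"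
      by (auto simp: \<theta>_def)
  qed
qed

text \<open>A tail of a convergent series; sums over primes are simply dominated by sums over all
  integers.\<close>

lemma small_tail_powr:
  fixes c \<eta> :: real
  assumes "0 \<le> c" "0 < \<eta>"
  obtains P :: real where
    "\<forall>F :: nat set. finite F \<and> (\<forall>n\<in>F. P < n) \<longrightarrow> (\<Sum>n\<in>F. c * n powr (- 1 - \<eta>)) \<le> 1 / 2"
proof -
  have "summable (\<lambda>n. c * real n powr (- 1 - \<eta>))"
    using assms by (intro summable_mult) (simp add: summable_real_powr_iff)
  then obtain N where N: "\<And>m n. m \<ge> N \<Longrightarrow> norm (\<Sum>n\<in>{m..<n}. c * real n powr (- 1 - \<eta>)) < 1 / 2"
    unfolding summable_Cauchy by (metis half_gt_zero_iff zero_less_one)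
  show thesis
  proof (rule that[of N], intro allI impI, elim conjE)
    fix F :: "nat set" assume F: "finite F" "\<forall>n\<in>F. real N < n"
    then obtain K where K: "\<And>n. n \<in> F \<Longrightarrow> n < K" by (meson finite_nat_set_iff_bounded)
    have "(\<Sum>n\<in>F. c * n powr (- 1 - \<eta>)) \<le> (\<Sum>n\<in>{N..<K}. c * n powr (- 1 - \<eta>))"
    proof (rule sum_mono2)
      show "F \<subseteq> {N..<K}" using F(2) K by fastforce
    qed (use assms in auto)
    also have "\<dots> \<le> 1 / 2" using N[of N K] by simp
    finally show "(\<Sum>n\<in>F. c * n powr (- 1 - \<eta>)) \<le> 1 / 2" .
  qed
qed

subsection \<open>Dividing out a prime\<close>

text \<open>Only \<open>0 < X i\<close> is asked, not \<open>1 \<le> X i\<close>: dividing by powers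
  of \<open>p\<close> can push the endpoints below 1, and the induction needs a class closed under
  this operation.\<close>

definition dyadic_sets :: "nat \<Rightarrow> (nat \<Rightarrow> real) \<Rightarrow> (nat \<Rightarrow> nat set) \<Rightarrow> bool" where
  "dyadic_sets k X A \<longleftrightarrow>
     (\<forall>i\<in>{1..k}. 0 < X i \<and> (\<forall>a\<in>A i. X i \<le> real a \<and> real a \<le> 2 * X i))"

lemma dyadic_pos: "dyadic_sets k X A \<Longrightarrow> i \<in> {1..k} \<Longrightarrow> a \<in> A i \<Longrightarrow> 0 < a"
  unfolding dyadic_sets_def by (metis gr0I linorder_not_less of_nat_0)

lemma dyadic_finite:
  assumes "dyadic_sets k X A" "i \<in> {1..k}"
  shows "finite (A i)"
proof (rule finite_subset)
  show "A i \<subseteq> {..nat \<lfloor>2 * X i\<rfloor>}"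
    using assms by (auto simp: dyadic_sets_def le_nat_floor)
qed simp

lemma finite_big_gcd_tuples:
  assumes "dyadic_sets k X A"
  shows "finite (big_gcd_tuples k D A)"
proof (rule finite_subset)
  show "finite (\<Pi>\<^sub>E i\<in>{1..k}. A i)" using dyadic_finite[OF assms] by (intro finite_PiE) auto
qed (auto simp: big_gcd_tuples_def)

lemma finite_prime_support:
  assumes "dyadic_sets k X A"
  shows "finite (prime_support (\<Union>i\<in>{1..k}. A i))"
proof (rule finite_subset)
  show "prime_support (\<Union>i\<in>{1..k}. A i) \<subseteq> (\<Union>i\<in>{1..k}. \<Union>a\<in>A i. {..a})"
  proof
    fix p assume "p \<in> prime_support (\<Union>i\<in>{1..k}. A i)"
    then obtain i a where "i \<in> {1..k}" "a \<in> A i" "p dvd a" by (auto simp: prime_support_def)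
    moreover from this have "p \<le> a" using dyadic_pos[OF assms] by (intro dvd_imp_le) auto
    ultimately show "p \<in> (\<Union>i\<in>{1..k}. \<Union>a\<in>A i. {..a})" by blast
  qed
  show "finite (\<Union>i\<in>{1..k}. \<Union>a\<in>A i. {..a})"
    using dyadic_finite[OF assms] by auto
qed

section \<open>Gcds, their valuations and the fibres over a valuation pattern\<close>

lemma Gcd_image_pos:
  fixes a :: "'i \<Rightarrow> nat"
  assumes "i \<in> I" "0 < a i"
  shows "0 < Gcd (a ` I)"
proof (rule ccontr)
  assume "\<not> ?thesis"
  then have "0 dvd a i" using assms(1) by (metis Gcd_dvd gr0I imageI)
  then show False using assms(2) by simp
qed

lemma multiplicity_Gcd_le:
  fixes a :: "'i \<Rightarrow> nat"
  assumes "i \<in> I" "0 < a i"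
  shows "multiplicity p (Gcd (a ` I)) \<le> multiplicity p (a i)"
  using assms by (intro dvd_imp_multiplicity_le) auto

text \<open>The valuation of a gcd is the minimum of the valuations. Hence the differences from it
  vanish somewhere, as \<open>shifts\<close> demands.\<close>

lemma multiplicity_Gcd_attained:
  fixes a :: "'i \<Rightarrow> nat"
  assumes "prime p" "finite I" "I \<noteq> {}" "\<And>i. i \<in> I \<Longrightarrow> 0 < a i"
  obtains i where "i \<in> I" "multiplicity p (a i) = multiplicity p (Gcd (a ` I))"
proof -
  define v where "v = Min ((\<lambda>i. multiplicity p (a i)) ` I)"
  have "v \<in> (\<lambda>i. multiplicity p (a i)) ` I"
    unfolding v_def using assms by (intro Min_in) auto
  then obtain i where i: "i \<in> I" "multiplicity p (a i) = v" by auto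
  have "p ^ v dvd Gcd (a ` I)"
  proof (rule Gcd_greatest)
    fix b assume "b \<in> a ` I"
    then obtain j where j: "j \<in> I" "b = a j" by auto
    then have "v \<le> multiplicity p b" using assms by (simp add: v_def)
    then show "p ^ v dvd b" by (rule multiplicity_dvd')
  qed
  moreover have "Gcd (a ` I) \<noteq> 0" using Gcd_image_pos[of i I a] i assms by (metis less_irrefl)
  ultimately have "v \<le> multiplicity p (Gcd (a ` I))"
    using assms(1) by (intro multiplicity_geI) auto
  with multiplicity_Gcd_le[of i I a p] i assms show thesis by (intro that[of i]) auto
qed

text \<open>Dividing coordinate \<open>i\<close> by \<open>p ^ (l + d i)\<close> is injective on the
  fibre. The part of the gcd prime to \<open>p\<close> still divides every quotient, so the gcd
  drops by at most the factor \<open>p ^ l\<close>.\<close>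

lemma card_fibre_le:
  fixes d :: "nat \<Rightarrow> nat" and l :: nat
  assumes p: "prime p" and k: "1 \<le> k" and A: "dyadic_sets k X A"
  defines "A' \<equiv> \<lambda>i. (\<lambda>a. a div p ^ (l + d i)) ` {a \<in> A i. multiplicity p a = l + d i}"
  shows "card {a \<in> big_gcd_tuples k D A. multiplicity p (Gcd (a ` {1..k})) = l \<and>
           (\<forall>i\<in>{1..k}. multiplicity p (a i) = l + d i)}
         \<le> card (big_gcd_tuples k (D / p ^ l) A')" (is "card ?F \<le> card ?G")
proof -
  define h where "h = (\<lambda>a. \<lambda>i\<in>{1..k}. a i div p ^ (l + d i))"
  have p0: "p > 0" using p by (simp add: prime_gt_0_nat)
  have eq: "a i = p ^ (l + d i) * h a i" if "a \<in> ?F" "i \<in> {1..k}" for a i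
  proof -
    have "p ^ (l + d i) dvd a i" using that by (auto intro: multiplicity_dvd')
    then show ?thesis using that by (simp add: h_def)
  qed
  have "inj_on h ?F"
  proof (rule inj_onI)
    fix a b assume ab: "a \<in> ?F" "b \<in> ?F" "h a = h b"
    have "a \<in> extensional {1..k}" "b \<in> extensional {1..k}"
      using ab by (auto simp: big_gcd_tuples_def PiE_def)
    then show "a = b"
    proof (rule extensionalityI)
      fix i assume "i \<in> {1..k}"
      then show "a i = b i" using eq[OF ab(1)] eq[OF ab(2)] ab(3) by metis
    qed
  qed
  moreover have "h ` ?F \<subseteq> ?G"
  proof
    fix b assume "b \<in> h ` ?F"
    then obtain a where a: "a \<in> ?F" and b: "b = h a" by auto
    have aA: "a i \<in> A i" if "i \<in> {1..k}" for i using a that by (auto simp: big_gcd_tuples_def)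
    have bA': "b \<in> (\<Pi>\<^sub>E i\<in>{1..k}. A' i)"
      unfolding b h_def A'_def using a aA by auto
    define g where "g = Gcd (a ` {1..k})"
    have g0: "g > 0"
      unfolding g_def using k dyadic_pos[OF A _ aA[of 1]] by (intro Gcd_image_pos[of 1]) auto
    have "multiplicity p g = l" using a by (simp add: g_def)
    then obtain g' where g': "g = p ^ l * g'" "\<not> p dvd g'"
      using multiplicity_decompose'[of g p] g0 not_prime_unit[of p] p by blast
    have "g' dvd Gcd (b ` {1..k})"
    proof (rule Gcd_greatest)
      fix c assume "c \<in> b ` {1..k}"
      then obtain i where i: "i \<in> {1..k}" "c = b i" by auto
      have "g' dvd a i" using i g' g_def by (metis Gcd_dvd dvd_mult_right imageI)
      then have "g' dvd p ^ (l + d i) * c" using eq[OF a i(1)] i b by simp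
      moreover have "coprime g' (p ^ (l + d i))"
        using p g'(2) by (metis coprime_commute coprime_power_left_iff prime_imp_coprime)
      ultimately show "g' dvd c" by (simp add: coprime_dvd_mult_right_iff)
    qed
    moreover have "Gcd (b ` {1..k}) > 0"
    proof -
      have "a 1 > 0" using k dyadic_pos[OF A _ aA[of 1]] by simp
      then have "b 1 > 0" using eq[OF a, of 1] k b by (cases "b 1") auto
      then show ?thesis using k by (intro Gcd_image_pos[of 1]) auto
    qed
    ultimately have "g' \<le> Gcd (b ` {1..k})" by (rule dvd_imp_le)
    then have "g \<le> p ^ l * Gcd (b ` {1..k})" using g' by simp
    then have "real g \<le> real p ^ l * Gcd (b ` {1..k})"
      by (metis of_nat_le_iff of_nat_mult of_nat_power)
    moreover have "D \<le> real g" using a by (auto simp: big_gcd_tuples_def g_def)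
    ultimately have "D / p ^ l \<le> Gcd (b ` {1..k})"
      using p0 by (simp add: divide_le_eq mult.commute)
    then show "b \<in> ?G" using bA' by (simp add: big_gcd_tuples_def)
  qed
  moreover have "finite ?G"
  proof -
    have "finite (A' i)" if "i \<in> {1..k}" for i
      using dyadic_finite[OF A that] by (simp add: A'_def)
    then have "finite (\<Pi>\<^sub>E i\<in>{1..k}. A' i)" by (intro finite_PiE) auto
    then show ?thesis by (rule rev_finite_subset) (auto simp: big_gcd_tuples_def)
  qed
  ultimately show ?thesis by (rule card_inj_on_le)
qed

text \<open>Coordinate \<open>i\<close> is a positive multiple of the common gcd \<open>G\<close>
  not exceeding \<open>2 * X i\<close>, which leaves at most \<open>2 * X i / G\<close> choices, and
  \<open>G \<ge> D\<close>.\<close>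

lemma card_common_gcd_le:
  assumes A: "dyadic_sets k X A" and D: "0 < D"
    and S: "S \<subseteq> big_gcd_tuples k D A" "\<And>a b. a \<in> S \<Longrightarrow> b \<in> S \<Longrightarrow> Gcd (a ` {1..k}) = Gcd (b ` {1..k})"
  shows "real (card S) \<le> 2 ^ k * ((\<Prod>i=1..k. X i) / D ^ k)"
proof (cases "S = {}")
  case True
  have "(\<Prod>i=1..k. X i) \<ge> 0" using A by (intro prod_nonneg) (auto simp: dyadic_sets_def less_imp_le)
  then show ?thesis using True D by simp
next
  case False
  then obtain a0 where a0: "a0 \<in> S" by auto
  define G where "G = Gcd (a0 ` {1..k})"
  have DG: "D \<le> real G" using a0 S(1) by (auto simp: big_gcd_tuples_def G_def)
  then have G: "G > 0" using D by (cases "G = 0") auto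
  define B where "B = (\<lambda>i. (\<lambda>j. G * j) ` {1..nat \<lfloor>2 * X i / G\<rfloor>})"
  have "S \<subseteq> (\<Pi>\<^sub>E i\<in>{1..k}. B i)"
  proof
    fix a assume a: "a \<in> S"
    then have aA: "a \<in> (\<Pi>\<^sub>E i\<in>{1..k}. A i)" using S(1) by (auto simp: big_gcd_tuples_def)
    show "a \<in> (\<Pi>\<^sub>E i\<in>{1..k}. B i)"
    proof (rule PiE_I)
      fix i assume i: "i \<in> {1..k}"
      have "Gcd (a ` {1..k}) = G" using S(2)[OF a a0] by (simp add: G_def)
      then have "G dvd a i" using i by (metis Gcd_dvd imageI)
      then obtain j where j: "a i = G * j" by (rule dvdE)
      have ai: "a i \<in> A i" using aA i by auto
      then have "j > 0" using dyadic_pos[OF A i] j by (metis gr0I mult_0_right less_irrefl)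
      moreover have "real G * real j \<le> 2 * X i"
        using A i ai j by (metis dyadic_sets_def of_nat_mult)
      then have "real j \<le> 2 * X i / G" using G by (simp add: field_simps)
      then have "j \<le> nat \<lfloor>2 * X i / G\<rfloor>" by (rule le_nat_floor)
      ultimately show "a i \<in> B i" using j by (auto simp: B_def)
    qed (use aA in auto)
  qed
  then have "card S \<le> card (\<Pi>\<^sub>E i\<in>{1..k}. B i)"
    by (intro card_mono finite_PiE) (auto simp: B_def)
  also have "\<dots> = (\<Prod>i=1..k. card (B i))" by (rule card_PiE) simp
  finally have "real (card S) \<le> (\<Prod>i=1..k. real (card (B i)))"
    by (metis of_nat_le_iff of_nat_prod)
  also have "\<dots> \<le> (\<Prod>i=1..k. 2 * X i / D)"
  proof (intro prod_mono conjI)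
    fix i assume i: "i \<in> {1..k}"
    have X: "X i > 0" using A i by (auto simp: dyadic_sets_def)
    have "card (B i) \<le> nat \<lfloor>2 * X i / G\<rfloor>" unfolding B_def by (rule order_trans[OF card_image_le]) auto
    also have "real (nat \<lfloor>2 * X i / G\<rfloor>) \<le> 2 * X i / G" using X by (intro of_nat_floor) simp
    also have "2 * X i / G \<le> 2 * X i / D" using X D DG by (intro divide_left_mono) auto
    finally show "real (card (B i)) \<le> 2 * X i / D" by simp
  qed simp
  also have "\<dots> = 2 ^ k * ((\<Prod>i=1..k. X i) / D ^ k)"
    by (simp add: prod.distrib prod_dividef)
  finally show ?thesis .
qed

lemma multiplicity_le_self:
  fixes p a :: nat
  assumes "prime p" "0 < a"
  shows "multiplicity p a \<le> a"
proof -
  have "multiplicity p a < 2 ^ multiplicity p a" by (rule less_exp)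
  also have "\<dots> \<le> p ^ multiplicity p a"
    using prime_ge_2_nat[OF assms(1)] by (intro power_mono) auto
  also have "\<dots> \<le> a" using assms(2) by (intro dvd_imp_le multiplicity_dvd)
  finally show ?thesis by simp
qed

text \<open>The tuples are split by the valuation \<open>l\<close> of the gcd and the shift
  \<open>d\<close>. The hypothesis \<open>IH\<close> applies to each divided fibre, whose sets no
  longer involve \<open>p\<close>, and the resulting factors are exactly the weights. The same
  profile serves every set \<open>L\<close>: all valuations give the total weight, the complement of
  one valuation gives the off-centre weight.\<close>

lemma prime_step:
  fixes K \<mu> r D :: real
  assumes p: "prime p" and k: "1 \<le> k" and A: "dyadic_sets k X A" and D: "0 < D"
    and ne: "\<And>i. i \<in> {1..k} \<Longrightarrow> A i \<noteq> {}"
    and \<mu>: "0 < \<mu>" and r: "0 < r" "r \<le> 1" "1 \<le> k * r" and K: "0 \<le> K"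
    and IH: "\<And>X' D' A'. dyadic_sets k X' A' \<Longrightarrow> 0 < D' \<Longrightarrow>
      prime_support (\<Union>i\<in>{1..k}. A' i) \<subseteq> prime_support (\<Union>i\<in>{1..k}. A i) - {p} \<Longrightarrow>
      real (card (big_gcd_tuples k D' A'))
        \<le> (K * ((\<Prod>i=1..k. X' i) / D' ^ k)) powr \<mu> * (\<Prod>i=1..k. real (card (A' i))) powr r"
  obtains M x where "profile {1..k} M x r (real p powr - \<mu>)"
    "\<And>L. real (card {a \<in> big_gcd_tuples k D A. multiplicity p (Gcd (a ` {1..k})) \<in> L})
       \<le> (K * ((\<Prod>i=1..k. X i) / D ^ k)) powr \<mu> * (\<Prod>i=1..k. real (card (A i))) powr r
          * (\<Sum>d\<in>profile.shifts {1..k} M. \<Sum>l | l \<le> M \<and> l \<in> L.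
               profile.weight {1..k} x r (real p powr - \<mu>) l d)"
proof -
  define \<theta> where "\<theta> = real p powr - \<mu>"
  define Ap where "Ap = (\<lambda>i j. {a \<in> A i. multiplicity p a = j})"
  define x where "x = (\<lambda>i j. real (card (Ap i j)) / card (A i))"
  define M where "M = Max (insert 0 (\<Union>i\<in>{1..k}. A i))"
  have p2: "real p \<ge> 2" using prime_ge_2_nat[OF p] by simp
  have fin: "finite (A i)" if "i \<in> {1..k}" for i using dyadic_finite[OF A that] .
  have card_A: "real (card (A i)) > 0" if "i \<in> {1..k}" for i
    using fin ne that by (simp add: card_gt_0_iff)
  have M: "multiplicity p a \<le> M" if "i \<in> {1..k}" "a \<in> A i" for i a
  proof -
    have "a \<le> M" unfolding M_def using that fin by (intro Max_ge) auto
    then show ?thesis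
      using multiplicity_le_self[OF p, of a] dyadic_pos[OF A that] by simp
  qed
  have prof: "profile {1..k} M x r \<theta>"
  proof
    fix i j assume i: "i \<in> {1..k}"
    show "0 \<le> x i j" by (simp add: x_def)
    show "x i j = 0" if "j > M"
    proof -
      have "Ap i j = {}" using M[OF i] that by (fastforce simp: Ap_def)
      then show ?thesis by (simp add: x_def)
    qed
    have "A i = (\<Union>j\<le>M. Ap i j)" using M[OF i] by (auto simp: Ap_def)
    then have "card (A i) = card (\<Union>j\<le>M. Ap i j)" by simp
    also have "\<dots> = (\<Sum>j\<le>M. card (Ap i j))"
      using fin[OF i] by (intro card_UN_disjoint) (auto simp: Ap_def)
    finally have "(\<Sum>j\<le>M. real (card (Ap i j))) = card (A i)" by simp
    then show "(\<Sum>j\<le>M. x i j) = 1"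
      using card_A[OF i] by (simp add: x_def sum_divide_distrib[symmetric])
  next
    show "\<theta> < 1" unfolding \<theta>_def using p2 \<mu> powr_less_mono[of "- \<mu>" 0 "real p"] by simp
  qed (use r k p2 in \<open>auto simp: \<theta>_def\<close>)
  interpret profile "{1..k}" M x r \<theta> by (rule prof)
  define Q where "Q = (K * ((\<Prod>i=1..k. X i) / D ^ k)) powr \<mu> * (\<Prod>i=1..k. real (card (A i))) powr r"
  define F where "F = (\<lambda>l d. {a \<in> big_gcd_tuples k D A. multiplicity p (Gcd (a ` {1..k})) = l \<and>
           (\<forall>i\<in>{1..k}. multiplicity p (a i) = l + d i)})"
  have fibre: "real (card (F l d)) \<le> Q * weight l d" for l d
  proof -
    define A' where "A' = (\<lambda>i. (\<lambda>a. a div p ^ (l + d i)) ` Ap i (l + d i))"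
    define X' where "X' = (\<lambda>i. X i / p ^ (l + d i))"
    have div_eq: "real (a div p ^ (l + d i)) = a / p ^ (l + d i)" if "a \<in> Ap i (l + d i)" for a i
      using that multiplicity_dvd'[of "l + d i" p a] by (simp add: Ap_def real_of_nat_div)
    have dy: "dyadic_sets k X' A'"
      unfolding dyadic_sets_def
    proof (intro ballI conjI)
      fix i assume i: "i \<in> {1..k}"
      show "0 < X' i" using A i p2 by (auto simp: dyadic_sets_def X'_def)
      fix b assume "b \<in> A' i"
      then obtain a where a: "a \<in> Ap i (l + d i)" "b = a div p ^ (l + d i)" by (auto simp: A'_def)
      then have "X i \<le> a" "a \<le> 2 * X i" using A i by (auto simp: dyadic_sets_def Ap_def)
      then show "X' i \<le> b" "b \<le> 2 * X' i"
        unfolding a(2) div_eq[OF a(1)] X'_def times_divide_eq_right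
        using p2 by (auto intro!: divide_right_mono)
    qed
    have support: "prime_support (\<Union>i\<in>{1..k}. A' i) \<subseteq> prime_support (\<Union>i\<in>{1..k}. A i) - {p}"
    proof
      fix q assume "q \<in> prime_support (\<Union>i\<in>{1..k}. A' i)"
      then obtain i b where q: "prime q" "i \<in> {1..k}" "b \<in> A' i" "q dvd b"
        by (auto simp: prime_support_def)
      then obtain a where a: "a \<in> Ap i (l + d i)" "b = a div p ^ (l + d i)" by (auto simp: A'_def)
      have aA: "a \<in> A i" "multiplicity p a = l + d i" using a by (auto simp: Ap_def)
      have "a > 0" using dyadic_pos[OF A q(2) aA(1)] .
      then have "\<not> p dvd b"
        using multiplicity_decompose[of a p] p aA a by (simp add: prime_nat_iff)
      moreover have "b dvd a" unfolding a(2) using aA(2) multiplicity_dvd[of p a]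
        by (metis dvd_div_mult_self dvd_triv_left)
      ultimately have "q dvd a" "q \<noteq> p" using q by (auto intro: dvd_trans)
      then show "q \<in> prime_support (\<Union>i\<in>{1..k}. A i) - {p}"
        unfolding prime_support_def using q(1,2) aA(1) by blast
    qed
    \<comment> \<open>The powers of \<open>p ^ l\<close> cancel between the \<open>k\<close>
      endpoints and the \<open>k\<close>-th power of \<open>D / p ^ l\<close>; only the shifts
      survive.\<close>
    have T: "(\<Prod>i=1..k. X' i) / (D / p ^ l) ^ k = (\<Prod>i=1..k. X i) / D ^ k * (1 / p ^ (\<Sum>i=1..k. d i))"
    proof -
      have "(\<Prod>i=1..k. X' i) = (\<Prod>i=1..k. X i) / (\<Prod>i=1..k. real p ^ l * real p ^ d i)"
        by (simp add: X'_def prod_dividef power_add)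
      also have "(\<Prod>i=1..k. real p ^ l * real p ^ d i) = (real p ^ l) ^ k * real p ^ (\<Sum>i=1..k. d i)"
        by (simp add: prod.distrib power_sum)
      finally show ?thesis using p2 D by (simp add: power_divide field_simps)
    qed
    have "card (F l d) \<le> card (big_gcd_tuples k (D / p ^ l) A')"
      unfolding F_def A'_def Ap_def by (rule card_fibre_le[OF p k A])
    then have "real (card (F l d)) \<le> card (big_gcd_tuples k (D / p ^ l) A')" by simp
    also have "\<dots> \<le> (K * ((\<Prod>i=1..k. X' i) / (D / p ^ l) ^ k)) powr \<mu>
        * (\<Prod>i=1..k. real (card (A' i))) powr r"
      using D p2 by (intro IH dy support) auto
    also have "\<dots> \<le> (K * ((\<Prod>i=1..k. X' i) / (D / p ^ l) ^ k)) powr \<mu>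
        * (\<Prod>i=1..k. x i (l + d i) * card (A i)) powr r"
    proof (intro mult_left_mono powr_mono2 prod_mono conjI prod_nonneg)
      fix i assume i: "i \<in> {1..k}"
      have "card (A' i) \<le> card (Ap i (l + d i))"
        unfolding A'_def using fin[OF i] by (intro card_image_le) (auto simp: Ap_def)
      then show "real (card (A' i)) \<le> x i (l + d i) * card (A i)"
        using card_A[OF i] by (simp add: x_def)
    qed (use r in auto)
    also have "(\<Prod>i=1..k. x i (l + d i) * card (A i)) powr r
        = (\<Prod>i=1..k. x i (l + d i) powr r) * (\<Prod>i=1..k. real (card (A i))) powr r"
      by (simp add: prod.distrib powr_mult prod_nonneg x_nonneg prod_powr_distrib)
    also have "(K * ((\<Prod>i=1..k. X' i) / (D / p ^ l) ^ k)) powr \<mu>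
        = (K * ((\<Prod>i=1..k. X i) / D ^ k)) powr \<mu> * \<theta> ^ (\<Sum>i=1..k. d i)"
    proof -
      have X0: "(\<Prod>i=1..k. X i) \<ge> 0"
        using A by (intro prod_nonneg) (auto simp: dyadic_sets_def less_imp_le)
      have "(1 / p ^ (\<Sum>i=1..k. d i)) powr \<mu> = \<theta> ^ (\<Sum>i=1..k. d i)"
        using p2 by (simp add: \<theta>_def powr_realpow[symmetric] powr_powr powr_divide powr_minus_divide mult.commute)
      then show ?thesis
        unfolding T mult.assoc[symmetric] by (subst powr_mult) (use K X0 D in auto)
    qed
    finally show ?thesis by (simp only: Q_def weight_def mult_ac)
  qed
  show thesis
  proof (rule that[of M x])
    show "profile {1..k} M x r (real p powr - \<mu>)" using prof by (simp add: \<theta>_def)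
    fix L :: "nat set"
    let ?E = "{a \<in> big_gcd_tuples k D A. multiplicity p (Gcd (a ` {1..k})) \<in> L}"
    have "?E \<subseteq> (\<Union>d\<in>shifts. \<Union>l\<in>{l. l \<le> M \<and> l \<in> L}. F l d)"
    proof
      fix a assume a: "a \<in> ?E"
      define l where "l = multiplicity p (Gcd (a ` {1..k}))"
      define d where "d = (\<lambda>i\<in>{1..k}. multiplicity p (a i) - l)"
      have aA: "a i \<in> A i" if "i \<in> {1..k}" for i
        using a that by (auto simp: big_gcd_tuples_def)
      have a_pos: "0 < a i" if "i \<in> {1..k}" for i using dyadic_pos[OF A that aA[OF that]] .
      have l_le: "l \<le> multiplicity p (a i)" if "i \<in> {1..k}" for i
        unfolding l_def using that a_pos by (intro multiplicity_Gcd_le)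
      obtain i0 where i0: "i0 \<in> {1..k}" "multiplicity p (a i0) = l"
        using multiplicity_Gcd_attained[of p "{1..k}" a] p k a_pos by (auto simp: l_def)
      have "l \<le> M" using i0 M[OF i0(1) aA[OF i0(1)]] by simp
      moreover have "d \<in> shifts"
        unfolding shifts_def
      proof (intro CollectI conjI PiE_I bexI)
        fix i assume i: "i \<in> {1..k}"
        show "d i \<in> {..M}" using M[OF i aA[OF i]] i by (simp add: d_def)
      qed (use i0 in \<open>auto simp: d_def\<close>)
      moreover have "a \<in> F l d"
        using a l_le by (auto simp: F_def l_def d_def)
      moreover have "l \<in> L" using a by (simp add: l_def)
      ultimately show "a \<in> (\<Union>d\<in>shifts. \<Union>l\<in>{l. l \<le> M \<and> l \<in> L}. F l d)" by blast
    qed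
    then have "card ?E \<le> card (\<Union>d\<in>shifts. \<Union>l\<in>{l. l \<le> M \<and> l \<in> L}. F l d)"
      using finite_big_gcd_tuples[OF A, of D] finite_shifts by (intro card_mono) (auto simp: F_def)
    also have "\<dots> \<le> (\<Sum>d\<in>shifts. card (\<Union>l\<in>{l. l \<le> M \<and> l \<in> L}. F l d))"
      by (rule card_UN_le[OF finite_shifts])
    also have "\<dots> \<le> (\<Sum>d\<in>shifts. \<Sum>l | l \<le> M \<and> l \<in> L. card (F l d))"
      by (intro sum_mono card_UN_le) auto
    finally have "real (card ?E) \<le> (\<Sum>d\<in>shifts. \<Sum>l | l \<le> M \<and> l \<in> L. real (card (F l d)))"
      by (metis (mono_tags, lifting) of_nat_le_iff of_nat_sum sum.cong)
    also have "\<dots> \<le> (\<Sum>d\<in>shifts. \<Sum>l | l \<le> M \<and> l \<in> L. Q * weight l d)"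
      by (intro sum_mono fibre)
    also have "\<dots> = Q * (\<Sum>d\<in>shifts. \<Sum>l | l \<le> M \<and> l \<in> L. weight l d)"
      by (simp add: sum_distrib_left)
    finally show "real (card ?E)
       \<le> (K * ((\<Prod>i=1..k. X i) / D ^ k)) powr \<mu> * (\<Prod>i=1..k. real (card (A i))) powr r
          * (\<Sum>d\<in>profile.shifts {1..k} M. \<Sum>l | l \<le> M \<and> l \<in> L.
               profile.weight {1..k} x r (real p powr - \<mu>) l d)"
      by (simp add: Q_def \<theta>_def)
  qed
qed

subsection \<open>Induction on the prime support\<close>

text \<open>By the union bound at least half of the tuples have the prescribed valuation
  \<open>m p\<close> at every \<open>p\<close> in \<open>P\<close>. Primes outside \<open>P\<close>
  divide no element, so all these tuples share one gcd.\<close>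

lemma card_le_of_typical_gcd:
  fixes m :: "nat \<Rightarrow> nat" and c :: "nat \<Rightarrow> real"
  assumes A: "dyadic_sets k X A" and k: "1 \<le> k" and D: "0 < D"
    and P: "P = prime_support (\<Union>i\<in>{1..k}. A i)"
    and bad: "\<And>p. p \<in> P \<Longrightarrow> real (card {a \<in> big_gcd_tuples k D A. multiplicity p (Gcd (a ` {1..k})) \<noteq> m p})
                \<le> c p * card (big_gcd_tuples k D A)"
    and c: "(\<Sum>p\<in>P. c p) \<le> 1 / 2"
  shows "real (card (big_gcd_tuples k D A)) \<le> 2 ^ (k + 1) * ((\<Prod>i=1..k. X i) / D ^ k)"
proof -
  let ?E = "big_gcd_tuples k D A"
  have finE: "finite ?E" by (rule finite_big_gcd_tuples[OF A])
  have finP: "finite P" unfolding P by (rule finite_prime_support[OF A])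
  define S where "S = {a \<in> ?E. \<forall>p\<in>P. multiplicity p (Gcd (a ` {1..k})) = m p}"
  define Bad where "Bad = (\<lambda>p. {a \<in> ?E. multiplicity p (Gcd (a ` {1..k})) \<noteq> m p})"
  have "?E \<subseteq> S \<union> (\<Union>p\<in>P. Bad p)" by (auto simp: S_def Bad_def)
  then have "card ?E \<le> card (S \<union> (\<Union>p\<in>P. Bad p))"
    using finE finP by (intro card_mono) (auto simp: S_def Bad_def)
  also have "\<dots> \<le> card S + card (\<Union>p\<in>P. Bad p)" by (rule card_Un_le)
  also have "\<dots> \<le> card S + (\<Sum>p\<in>P. card (Bad p))" by (intro add_left_mono card_UN_le finP)
  finally have "real (card ?E) \<le> card S + (\<Sum>p\<in>P. real (card (Bad p)))"
    by (metis of_nat_add of_nat_le_iff of_nat_sum)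
  also have "(\<Sum>p\<in>P. real (card (Bad p))) \<le> (\<Sum>p\<in>P. c p * card ?E)"
    unfolding Bad_def by (intro sum_mono bad)
  also have "\<dots> \<le> 1 / 2 * card ?E"
    unfolding sum_distrib_right[symmetric] using c by (intro mult_right_mono) auto
  finally have half: "real (card ?E) \<le> 2 * card S" by simp
  have aux: "multiplicity p (Gcd (a ` {1..k})) = (if p \<in> P then m p else 0)"
    if a: "a \<in> S" and p: "prime p" for a p
  proof (cases "p \<in> P")
    case False
    have a1: "a 1 \<in> A 1" using a k by (auto simp: S_def big_gcd_tuples_def)
    then have "\<not> p dvd a 1" using False p k by (auto simp: P prime_support_def)
    moreover have "Gcd (a ` {1..k}) dvd a 1" using k by (intro Gcd_dvd) auto
    ultimately have "\<not> p dvd Gcd (a ` {1..k})" using dvd_trans by blast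
    then show ?thesis using False by (simp add: not_dvd_imp_multiplicity_0)
  qed (use a in \<open>auto simp: S_def\<close>)
  have "real (card S) \<le> 2 ^ k * ((\<Prod>i=1..k. X i) / D ^ k)"
  proof (rule card_common_gcd_le[OF A D])
    show "S \<subseteq> ?E" by (auto simp: S_def)
    fix a b assume ab: "a \<in> S" "b \<in> S"
    have pos: "0 < Gcd (a ` {1..k})" if "a \<in> S" for a
    proof -
      have "a 1 \<in> A 1" using that k by (auto simp: S_def big_gcd_tuples_def)
      then show ?thesis using k dyadic_pos[OF A, of 1] by (intro Gcd_image_pos[of 1]) auto
    qed
    show "Gcd (a ` {1..k}) = Gcd (b ` {1..k})"
      by (rule multiplicity_eq_nat[OF pos[OF ab(1)] pos[OF ab(2)]]) (simp only: aux[OF ab(1)] aux[OF ab(2)])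
  qed
  with half show ?thesis by simp
qed

text \<open>Strong induction on the number of primes involved. A small prime is removed at the cost
  of one factor of the constant. Without small primes, either some prime has total weight at most 1
  and can be removed free of charge, or every prime has a typical valuation and the tuples are
  counted directly. The second alternative includes the case of no primes at all.\<close>

lemma card_big_gcd_tuples_le:
  fixes c :: "nat \<Rightarrow> real" and \<mu> r p0 D :: real
  assumes k: "1 \<le> k" and \<mu>: "0 < \<mu>" and r: "0 < r" "1 \<le> k * r" and sum1: "\<mu> + r = 1"
    and small: "(1 / (1 - 2 powr - \<mu>)) ^ k \<le> (2 ^ (4 * k)) powr \<mu>"
    and large: "\<And>M x p. prime p \<Longrightarrow> p0 < real p \<Longrightarrow> profile {1..k} M x r (real p powr - \<mu>) \<Longrightarrow>
       1 < (\<Sum>d\<in>profile.shifts {1..k} M. \<Sum>l\<le>M. profile.weight {1..k} x r (real p powr - \<mu>) l d) \<Longrightarrow>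
       \<exists>m. (\<Sum>d\<in>profile.shifts {1..k} M. \<Sum>l | l \<le> M \<and> l \<noteq> m.
               profile.weight {1..k} x r (real p powr - \<mu>) l d) \<le> c p"
    and c0: "\<And>p. 0 \<le> c p"
    and tail: "\<And>F. finite F \<Longrightarrow> (\<And>p. p \<in> F \<Longrightarrow> p0 < real p) \<Longrightarrow> (\<Sum>p\<in>F. c p) \<le> 1 / 2"
    and A: "dyadic_sets k X A" and D: "0 < D"
  shows "real (card (big_gcd_tuples k D A))
    \<le> ((2 ^ (4 * k)) ^ (1 + card (prime_support_small p0 (\<Union>i\<in>{1..k}. A i)))
        * ((\<Prod>i=1..k. X i) / D ^ k)) powr \<mu> * (\<Prod>i=1..k. real (card (A i))) powr r"
  using A D
proof (induction "card (prime_support (\<Union>i\<in>{1..k}. A i))" arbitrary: X D A rule: less_induct)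
  case less
  note A = less.prems(1) and D = less.prems(2)
  define P where "P = prime_support (\<Union>i\<in>{1..k}. A i)"
  define Ps where "Ps = prime_support_small p0 (\<Union>i\<in>{1..k}. A i)"
  define C :: real where "C = 2 ^ (4 * k)"
  define T where "T = (\<Prod>i=1..k. X i) / D ^ k"
  define N where "N = (\<Prod>i=1..k. real (card (A i)))"
  let ?E = "big_gcd_tuples k D A"
  have C1: "1 \<le> C" by (simp add: C_def)
  have T0: "0 \<le> T"
    using A D unfolding T_def by (intro divide_nonneg_pos prod_nonneg) (auto simp: dyadic_sets_def less_imp_le)
  have finP: "finite P" unfolding P_def by (rule finite_prime_support[OF A])
  have finPs: "finite Ps" by (rule finite_subset[OF _ finP]) (auto simp: Ps_def P_def prime_support_small_def)
  have Cn: "0 \<le> C ^ (1 + n)" for n using C1 by simp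
  have r1: "r \<le> 1" using \<mu> sum1 by simp
  \<comment> \<open>Any \<open>n\<close> from the number of remaining small primes upwards is
    allowed, so that one exponent covers all fibres at \<open>p\<close>.\<close>
  have IH: "real (card (big_gcd_tuples k D' A'))
        \<le> (C ^ (1 + n) * ((\<Prod>i=1..k. X' i) / D' ^ k)) powr \<mu> * (\<Prod>i=1..k. real (card (A' i))) powr r"
    if p: "p \<in> P" and A': "dyadic_sets k X' A'" and D': "0 < D'"
      and sub: "prime_support (\<Union>i\<in>{1..k}. A' i) \<subseteq> prime_support (\<Union>i\<in>{1..k}. A i) - {p}"
      and n: "card (Ps - {p}) \<le> n" for p X' D' A' n
  proof -
    define s where "s = card (prime_support_small p0 (\<Union>i\<in>{1..k}. A' i))"
    have "card (prime_support (\<Union>i\<in>{1..k}. A' i)) \<le> card (P - {p})"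
      using sub finP unfolding P_def[symmetric] by (intro card_mono) auto
    also have "\<dots> < card P" using p finP by (intro psubset_card_mono) auto
    finally have "real (card (big_gcd_tuples k D' A'))
        \<le> (C ^ (1 + s) * ((\<Prod>i=1..k. X' i) / D' ^ k)) powr \<mu> * (\<Prod>i=1..k. real (card (A' i))) powr r"
      using less.hyps[OF _ A' D'] unfolding P_def s_def C_def by blast
    also have "\<dots> \<le> (C ^ (1 + n) * ((\<Prod>i=1..k. X' i) / D' ^ k)) powr \<mu> * (\<Prod>i=1..k. real (card (A' i))) powr r"
    proof (intro mult_right_mono powr_mono2 power_increasing)
      have "s \<le> card (Ps - {p})"
        unfolding s_def using sub finPs
        by (intro card_mono) (auto simp: Ps_def prime_support_small_def)
      then show "1 + s \<le> 1 + n" using n by simp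
      have X'0: "0 \<le> (\<Prod>i=1..k. X' i)"
        using A' by (intro prod_nonneg) (auto simp: dyadic_sets_def less_imp_le)
      then show "0 \<le> (\<Prod>i=1..k. X' i) / D' ^ k" "0 \<le> C ^ (1 + s) * ((\<Prod>i=1..k. X' i) / D' ^ k)"
        using D' C1 by auto
    qed (use C1 \<mu> in auto)
    finally show ?thesis .
  qed
  have goal: "real (card ?E) \<le> (C ^ (1 + card Ps) * T) powr \<mu> * N powr r"
  proof (cases "\<exists>i\<in>{1..k}. A i = {}")
    case True
    then have "?E = {}" by (auto simp: big_gcd_tuples_def PiE_eq_empty_iff)
    then show ?thesis by simp
  next
    case False
    then have ne: "A i \<noteq> {}" if "i \<in> {1..k}" for i using that by blast
    show ?thesis
    proof (cases "Ps = {}")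
      case False
      then obtain p where p: "p \<in> Ps" by auto
      then have pP: "p \<in> P" and prime: "prime p"
        by (auto simp: Ps_def P_def prime_support_small_def prime_support_def)
      define n where "n = card (Ps - {p})"
      have n: "card Ps = Suc n" using card_Suc_Diff1[OF finPs p] by (simp add: n_def)
      obtain M x where prof: "profile {1..k} M x r (real p powr - \<mu>)" and
        le: "\<And>L. real (card {a \<in> ?E. multiplicity p (Gcd (a ` {1..k})) \<in> L})
           \<le> (C ^ (1 + n) * T) powr \<mu> * N powr r
              * (\<Sum>d\<in>profile.shifts {1..k} M. \<Sum>l | l \<le> M \<and> l \<in> L.
                   profile.weight {1..k} x r (real p powr - \<mu>) l d)"
        by (rule prime_step[OF prime k A D ne \<mu> r(1) r1 r(2) Cn IH[OF pP], of n, folded T_def N_def])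
          (simp_all add: n_def)
      interpret profile "{1..k}" M x r "real p powr - \<mu>" by (rule prof)
      have "real (card ?E) \<le> (C ^ (1 + n) * T) powr \<mu> * N powr r
              * (\<Sum>d\<in>shifts. \<Sum>l\<le>M. weight l d)"
        using le[of UNIV] by (simp add: atMost_def)
      also have "\<dots> \<le> (C ^ (1 + n) * T) powr \<mu> * N powr r * C powr \<mu>"
      proof (intro mult_left_mono)
        have "(\<Sum>d\<in>shifts. \<Sum>l\<le>M. weight l d) \<le> (1 / (1 - real p powr - \<mu>)) ^ k"
          using total_weight_le by simp
        also have "\<dots> \<le> (1 / (1 - 2 powr - \<mu>)) ^ k"
        proof (intro power_mono divide_left_mono)
          have "real p powr - \<mu> \<le> 2 powr - \<mu>"
            using prime_ge_2_nat[OF prime] \<mu> by (intro powr_mono2') auto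
          then show "1 - 2 powr - \<mu> \<le> 1 - real p powr - \<mu>" by simp
          have "2 powr - \<mu> < (1 :: real)" using \<mu> powr_less_mono[of "- \<mu>" 0 "2 :: real"] by simp
          then show "0 < (1 - real p powr - \<mu>) * (1 - 2 powr - \<mu>)" using \<theta>_less_1 by simp
        qed (use \<theta>_less_1 in auto)
        also have "\<dots> \<le> C powr \<mu>" using small by (simp add: C_def)
        finally show "(\<Sum>d\<in>shifts. \<Sum>l\<le>M. weight l d) \<le> C powr \<mu>" .
      qed auto
      also have "\<dots> = (C ^ (1 + card Ps) * T) powr \<mu> * N powr r"
      proof -
        have "C ^ (1 + card Ps) * T = C ^ (1 + n) * T * C" by (simp add: n)
        then have "(C ^ (1 + card Ps) * T) powr \<mu> = (C ^ (1 + n) * T) powr \<mu> * C powr \<mu>"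
          by (simp only: powr_mult)
        then show ?thesis by (simp only: mult_ac)
      qed
      finally show ?thesis .
    next
      case True
      define Q where "Q = (C * T) powr \<mu> * N powr r"
      have large_P: "p0 < real p" if "p \<in> P" for p
        using True that by (fastforce simp: Ps_def P_def prime_support_small_def)
      have dich: "real (card ?E) \<le> Q \<or> (\<exists>m. real (card {a \<in> ?E. multiplicity p (Gcd (a ` {1..k})) \<noteq> m}) \<le> Q * c p)"
        if pP: "p \<in> P" for p
      proof -
        have prime: "prime p" using pP by (auto simp: P_def prime_support_def)
        obtain M x where prof: "profile {1..k} M x r (real p powr - \<mu>)" and
          le: "\<And>L. real (card {a \<in> ?E. multiplicity p (Gcd (a ` {1..k})) \<in> L})
             \<le> (C ^ (1 + 0) * T) powr \<mu> * N powr r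
                * (\<Sum>d\<in>profile.shifts {1..k} M. \<Sum>l | l \<le> M \<and> l \<in> L.
                     profile.weight {1..k} x r (real p powr - \<mu>) l d)"
          by (rule prime_step[OF prime k A D ne \<mu> r(1) r1 r(2) Cn IH[OF pP], of 0, folded T_def N_def])
            (simp_all add: True)
        interpret profile "{1..k}" M x r "real p powr - \<mu>" by (rule prof)
        show ?thesis
        proof (cases "1 < (\<Sum>d\<in>shifts. \<Sum>l\<le>M. weight l d)")
          case True
          then obtain m where m: "(\<Sum>d\<in>shifts. \<Sum>l | l \<le> M \<and> l \<noteq> m. weight l d) \<le> c p"
            using large[OF prime large_P[OF pP] prof] by blast
          have "real (card {a \<in> ?E. multiplicity p (Gcd (a ` {1..k})) \<noteq> m})
              \<le> Q * (\<Sum>d\<in>shifts. \<Sum>l | l \<le> M \<and> l \<noteq> m. weight l d)"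
            using le[of "- {m}"] by (simp add: Q_def)
          also have "\<dots> \<le> Q * c p" using m by (intro mult_left_mono) (auto simp: Q_def)
          finally show ?thesis by blast
        next
          case False
          have "real (card ?E) \<le> Q * (\<Sum>d\<in>shifts. \<Sum>l\<le>M. weight l d)"
            using le[of UNIV] by (simp add: Q_def atMost_def)
          also have "\<dots> \<le> Q * 1" using False by (intro mult_left_mono) (auto simp: Q_def)
          finally show ?thesis by simp
        qed
      qed
      have "real (card ?E) \<le> Q"
      proof (rule ccontr)
        assume not: "\<not> ?thesis"
        then have "\<forall>p\<in>P. \<exists>m. real (card {a \<in> ?E. multiplicity p (Gcd (a ` {1..k})) \<noteq> m}) \<le> Q * c p"
          using dich by blast
        from bchoice[OF this] obtain m where m: "\<And>p. p \<in> P \<Longrightarrow>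
            real (card {a \<in> ?E. multiplicity p (Gcd (a ` {1..k})) \<noteq> m p}) \<le> Q * c p"
          by blast
        have E_le: "real (card ?E) \<le> 2 ^ (k + 1) * T"
          unfolding T_def
        proof (rule card_le_of_typical_gcd[OF A k D P_def])
          fix p assume "p \<in> P"
          note m[OF this]
          \<comment> \<open>The assumed failure of the bound, \<open>Q\<close> below the number of
            tuples, turns the estimate relative to \<open>Q\<close> into one relative to the number
            of tuples.\<close>
          also have "Q * c p \<le> c p * card ?E" using not mult_left_mono[OF _ c0, of Q "card ?E" p]
            by (simp add: mult.commute)
          finally show "real (card {a \<in> ?E. multiplicity p (Gcd (a ` {1..k})) \<noteq> m p}) \<le> c p * card ?E" .
        qed (use tail[OF finP] large_P in auto)
        have E_le_N: "real (card ?E) \<le> N"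
        proof -
          have "card ?E \<le> card (\<Pi>\<^sub>E i\<in>{1..k}. A i)"
            using dyadic_finite[OF A] by (intro card_mono finite_PiE) (auto simp: big_gcd_tuples_def)
          also have "\<dots> = (\<Prod>i=1..k. card (A i))" by (simp add: card_PiE)
          finally show ?thesis unfolding N_def by (metis of_nat_le_iff of_nat_prod)
        qed
        \<comment> \<open>Interpolation between the bounds \<open>C * T\<close> and
          \<open>N\<close>, possible because \<open>\<mu> + r = 1\<close>.\<close>
        have "real (card ?E) = real (card ?E) powr \<mu> * real (card ?E) powr r"
          by (simp add: powr_add[symmetric] sum1)
        also have "\<dots> \<le> (C * T) powr \<mu> * N powr r"
        proof (intro mult_mono powr_mono2)
          have "(2 :: real) ^ (k + 1) \<le> C" unfolding C_def using k by (intro power_increasing) auto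
          then show "real (card ?E) \<le> C * T"
            using E_le T0 mult_right_mono[of "2 ^ (k + 1)" C T] by linarith
        qed (use \<mu> r E_le_N in auto)
        finally show False using not by (simp add: Q_def)
      qed
      then show ?thesis using True by (simp add: Q_def)
    qed
  qed
  then show ?case by (simp only: C_def T_def N_def Ps_def)
qed

section \<open>Numerical estimates and the deduction of the theorem\<close>

text \<open>With \<open>t = 2 powr - \<mu>\<close> the claim follows from
  \<open>t ^ 4 \<le> 1 - t\<close>, which holds for \<open>t \<le> 7 / 10\<close>. The fourth power
  is the source of the exponent \<open>4 * k\<close> in the constant.\<close>

lemma small_prime_factor_le:
  fixes \<mu> :: real
  assumes "4 / 7 \<le> \<mu>"
  shows "(1 / (1 - 2 powr - \<mu>)) ^ k \<le> (2 ^ (4 * k)) powr \<mu>"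
proof -
  define t where "t = (2 :: real) powr - \<mu>"
  have t0: "t > 0" by (simp add: t_def)
  have "t \<le> 2 powr - (4 / 7)" unfolding t_def using assms by (intro powr_mono) auto
  also have "\<dots> \<le> 7 / 10"
  proof -
    have "(2 powr - (4 / 7)) ^ 7 = (2 :: real) powr - 4"
      by (simp add: powr_realpow[symmetric] powr_powr)
    also have "\<dots> = 1 / 16" by (simp add: powr_minus_divide)
    also have "\<dots> \<le> (7 / 10 :: real) ^ 7" by (simp add: power_divide)
    finally show ?thesis by (rule power_le_imp_le_base[of _ 6, simplified]) auto
  qed
  finally have t: "t \<le> 7 / 10" .
  have "t ^ 4 \<le> (7 / 10) ^ 4" using t t0 by (intro power_mono) auto
  also have "\<dots> \<le> (3 / 10 :: real)" by (simp add: power_divide)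
  finally have "t ^ 4 \<le> 1 - t" using t by simp
  then have "1 / (1 - t) \<le> 1 / t ^ 4" using t t0 by (intro divide_left_mono) auto
  then have "(1 / (1 - t)) ^ k \<le> (1 / t ^ 4) ^ k" using t by (intro power_mono) auto
  also have "\<dots> = (1 / t) ^ (4 * k)" by (simp add: power_mult power_one_over)
  also have "1 / t = 2 powr \<mu>" by (simp add: t_def powr_minus_divide)
  also have "(2 powr \<mu>) ^ (4 * k) = (2 powr real (4 * k)) powr \<mu>"
    by (simp add: powr_power powr_powr mult.commute)
  also have "(2 :: real) powr real (4 * k) = 2 ^ (4 * k)" by (rule powr_realpow) simp
  finally show ?thesis by (simp add: t_def)
qed

lemma card_prime_support_small_le: "card (prime_support_small p0 S) \<le> nat \<lfloor>p0\<rfloor>"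
proof -
  have "prime_support_small p0 S \<subseteq> {1..nat \<lfloor>p0\<rfloor>}"
    by (auto simp: prime_support_small_def prime_support_def prime_ge_Suc_0_nat le_nat_floor)
  from card_mono[OF _ this] show ?thesis by simp
qed

text \<open>The density hypothesis bounds \<open>\<delta>\<close> times the product of cardinalities
  by the number of tuples. Cancelling the power \<open>r\<close> of that product leaves its power
  \<open>\<mu>\<close>, and the root of order \<open>\<mu>\<close> gives the claim.\<close>

lemma gcd_setup_prod_card_le:
  fixes \<mu> r K D \<delta> :: real
  assumes data: "gcd_setup k X D \<delta> A" and \<mu>: "0 < \<mu>" and sum1: "\<mu> + r = 1" and K: "0 \<le> K"
    and le: "real (card (big_gcd_tuples k D A))
      \<le> (K * ((\<Prod>i=1..k. X i) / D ^ k)) powr \<mu> * (\<Prod>i=1..k. real (card (A i))) powr r"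
  shows "(\<Prod>i=1..k. real (card (A i))) \<le> K * \<delta> powr (- (1 / \<mu>)) * ((\<Prod>i=1..k. X i) / D ^ k)"
proof -
  define N where "N = (\<Prod>i=1..k. real (card (A i)))"
  define T where "T = (\<Prod>i=1..k. X i) / D ^ k"
  have \<delta>: "0 < \<delta>" and \<delta>N: "\<delta> * N \<le> card (big_gcd_tuples k D A)"
    using data by (auto simp: gcd_setup_def N_def)
  have T: "0 \<le> T"
    unfolding T_def using data
    by (intro divide_nonneg_nonneg prod_nonneg) (auto simp: gcd_setup_def intro: order_trans[OF zero_le_one])
  have N0: "0 \<le> N" unfolding N_def by (intro prod_nonneg) auto
  have "N \<le> K * \<delta> powr (- (1 / \<mu>)) * T"
  proof (cases "N = 0")
    case True
    then show ?thesis using K T by simp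
  next
    case False
    then have N: "N > 0" using N0 by simp
    have "\<delta> * (N powr \<mu> * N powr r) = \<delta> * N" using N by (simp add: powr_add[symmetric] sum1)
    also have "\<dots> \<le> (K * T) powr \<mu> * N powr r" using \<delta>N le by (simp add: N_def T_def)
    finally have "(\<delta> * N powr \<mu>) * N powr r \<le> (K * T) powr \<mu> * N powr r" by (simp only: mult.assoc)
    then have "\<delta> * N powr \<mu> \<le> (K * T) powr \<mu>" using N by simp
    then have "N powr \<mu> \<le> (K * T) powr \<mu> * \<delta> powr - 1"
      using \<delta> by (simp add: powr_minus_divide field_simps)
    then have "(N powr \<mu>) powr (1 / \<mu>) \<le> ((K * T) powr \<mu> * \<delta> powr - 1) powr (1 / \<mu>)"
      using \<mu> by (intro powr_mono2) auto
    also have "\<dots> = ((K * T) powr \<mu>) powr (1 / \<mu>) * (\<delta> powr - 1) powr (1 / \<mu>)" by (rule powr_mult)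
    also have "\<dots> = K * T * \<delta> powr (- (1 / \<mu>))"
      unfolding powr_powr using \<mu> K T by simp
    finally show ?thesis using \<mu> N by (simp add: powr_powr mult_ac)
  qed
  then show ?thesis by (simp only: N_def T_def)
qed

theorem theorem1p1:
  fixes k :: nat and \<epsilon> :: real
  assumes "k \<ge> 3" and "0 < \<epsilon>" and "\<epsilon> < 1"
  shows
    "(\<exists>P::real. \<forall>p0\<ge>P. \<forall>(X :: nat \<Rightarrow> real) (D :: real) (\<delta> :: real) (A :: nat \<Rightarrow> nat set).
        gcd_setup k X D \<delta> A \<longrightarrow>
        (\<Prod>i=1..k. real (card (A i)))
          \<le> (2 ^ (4 * k)) ^ (1 + card (prime_support_small p0 (\<Union>i\<in>{1..k}. A i)))
            * \<delta> powr (- ((real k + \<epsilon> / (real k - 1)) / (real k - 1)))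
            * ((\<Prod>i=1..k. X i) / D ^ k))
     \<and>
     (\<exists>C::real. C > 0 \<and>
        (\<forall>(X :: nat \<Rightarrow> real) (D :: real) (\<delta> :: real) (A :: nat \<Rightarrow> nat set).
        gcd_setup k X D \<delta> A \<longrightarrow>
        (\<Prod>i=1..k. real (card (A i)))
          \<le> C * \<delta> powr (- (real k / (real k - 1)) - \<epsilon>)
            * ((\<Prod>i=1..k. X i) / D ^ k)))"
proof -
  define e where "e = \<epsilon> / (real k - 1)"
  have k3: "real k \<ge> 3" using assms(1) by simp
  have e: "0 < e" "e < 1 / 2" using assms k3 by (auto simp: e_def divide_less_eq)
  \<comment> \<open>Chosen so that \<open>1 / \<mu>\<close> is the exponent of
    \<open>\<delta>\<close> in the claim; \<open>r\<close> is \<open>1 - \<mu>\<close>.\<close>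
  define \<mu> where "\<mu> = (real k - 1) / (real k + e)"
  define r where "r = (1 + e) / (real k + e)"
  have sum1: "\<mu> + r = 1" using k3 e by (simp add: \<mu>_def r_def add_divide_distrib[symmetric])
  have r_pos: "0 < r" and \<mu>_pos: "0 < \<mu>" using k3 e by (auto simp: \<mu>_def r_def)
  have r_le: "r \<le> \<mu>" using k3 e unfolding \<mu>_def r_def by (intro divide_right_mono) auto
  \<comment> \<open>The excess over 1 is \<open>(k - 1) * e / (k + e)\<close>, positive because
    \<open>\<epsilon>\<close> is.\<close>
  have kr: "1 < k * r"
  proof -
    have "1 * e < k * e" using k3 e by (intro mult_strict_right_mono) auto
    then show ?thesis using k3 e by (simp add: r_def less_divide_eq distrib_left)
  qed
  \<comment> \<open>The excess over 1 is \<open>(k - 2) * (1 + e) / (k + e)\<close>; for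
    \<open>k = 2\<close> it would vanish.\<close>
  have kr': "1 < \<mu> + (k - 1) * r"
  proof -
    have "\<mu> + (k - 1) * r = (real k - 1) * (2 + e) / (real k + e)"
      using assms(1) by (simp add: \<mu>_def r_def of_nat_diff add_divide_distrib[symmetric] algebra_simps)
    moreover have "real k + e < (real k - 1) * (2 + e)"
    proof -
      have "3 * e \<le> real k * e" using k3 e by (intro mult_right_mono) auto
      moreover have "(real k - 1) * (2 + e) = 2 * real k - 2 + real k * e - e" by algebra
      ultimately show ?thesis using k3 e by linarith
    qed
    ultimately show ?thesis using k3 e by (simp add: less_divide_eq)
  qed
  \<comment> \<open>The extreme values \<open>k = 3\<close> and \<open>e = 1 / 2\<close> give
    4/7.\<close>
  have \<mu>_ge: "4 / 7 \<le> \<mu>" using k3 e by (simp add: \<mu>_def le_divide_eq)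
  have inv_\<mu>: "1 / \<mu> = (real k + \<epsilon> / (real k - 1)) / (real k - 1)" by (simp add: \<mu>_def e_def)
  obtain P1 c \<eta> :: real where "1 \<le> P1" and P1: "0 \<le> c" "0 < \<eta>" and off_centre:
    "\<forall>(I :: nat set) M x p. P1 \<le> p \<and> card I = k \<and> profile I M x r (p powr - \<mu>) \<and>
       1 < (\<Sum>d\<in>profile.shifts I M. \<Sum>l\<le>M. profile.weight I x r (p powr - \<mu>) l d) \<longrightarrow>
       (\<exists>m. (\<Sum>d\<in>profile.shifts I M. \<Sum>l | l \<le> M \<and> l \<noteq> m. profile.weight I x r (p powr - \<mu>) l d)
             \<le> c * p powr (- 1 - \<eta>))"
    by (rule off_centre_threshold[where ?'i = nat, OF sum1 r_pos r_le kr kr'])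
  obtain P2 :: real where tail:
    "\<forall>F :: nat set. finite F \<and> (\<forall>n\<in>F. P2 < n) \<longrightarrow> (\<Sum>n\<in>F. c * n powr (- 1 - \<eta>)) \<le> 1 / 2"
    by (rule small_tail_powr[OF P1])
  define P where "P = max P1 P2"
  have bound: "(\<Prod>i=1..k. real (card (A i)))
          \<le> (2 ^ (4 * k)) ^ (1 + card (prime_support_small p0 (\<Union>i\<in>{1..k}. A i)))
            * \<delta> powr (- (1 / \<mu>)) * ((\<Prod>i=1..k. X i) / D ^ k)"
    if p0: "P \<le> p0" and data: "gcd_setup k X D \<delta> A" for p0 X D \<delta> A
  proof (rule gcd_setup_prod_card_le[OF data \<mu>_pos sum1])
    show "real (card (big_gcd_tuples k D A))
      \<le> ((2 ^ (4 * k)) ^ (1 + card (prime_support_small p0 (\<Union>i\<in>{1..k}. A i)))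
          * ((\<Prod>i=1..k. X i) / D ^ k)) powr \<mu> * (\<Prod>i=1..k. real (card (A i))) powr r"
    proof (rule card_big_gcd_tuples_le[where c = "\<lambda>p. c * real p powr (- 1 - \<eta>)"])
      show "(1 / (1 - 2 powr - \<mu>)) ^ k \<le> (2 ^ (4 * k)) powr \<mu>"
        by (rule small_prime_factor_le[OF \<mu>_ge])
      show "dyadic_sets k X A"
        using data unfolding gcd_setup_def dyadic_sets_def by force
      show "0 < D" using data by (simp add: gcd_setup_def)
      show "(\<Sum>p\<in>F. c * real p powr (- 1 - \<eta>)) \<le> 1 / 2"
        if "finite F" "\<And>p. p \<in> F \<Longrightarrow> p0 < real p" for F :: "nat set"
        using that p0 by (intro tail[rule_format]) (auto simp: P_def intro: le_less_trans)
      show "\<exists>m. (\<Sum>d\<in>profile.shifts {1..k} M. \<Sum>l | l \<le> M \<and> l \<noteq> m.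
               profile.weight {1..k} x r (real p powr - \<mu>) l d) \<le> c * real p powr (- 1 - \<eta>)"
        if "p0 < real p" "profile {1..k} M x r (real p powr - \<mu>)"
          "1 < (\<Sum>d\<in>profile.shifts {1..k} M. \<Sum>l\<le>M. profile.weight {1..k} x r (real p powr - \<mu>) l d)"
        for M x and p :: nat
        using that p0 by (intro off_centre[rule_format]) (auto simp: P_def)
    qed (use assms(1) \<mu>_pos r_pos kr sum1 P1 in auto)
  qed simp
  show ?thesis
  proof
    show "\<exists>P::real. \<forall>p0\<ge>P. \<forall>(X :: nat \<Rightarrow> real) (D :: real) (\<delta> :: real) (A :: nat \<Rightarrow> nat set).
        gcd_setup k X D \<delta> A \<longrightarrow>
        (\<Prod>i=1..k. real (card (A i)))
          \<le> (2 ^ (4 * k)) ^ (1 + card (prime_support_small p0 (\<Union>i\<in>{1..k}. A i)))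
            * \<delta> powr (- ((real k + \<epsilon> / (real k - 1)) / (real k - 1)))
            * ((\<Prod>i=1..k. X i) / D ^ k)"
      using bound unfolding inv_\<mu> by blast
    \<comment> \<open>The first bound is taken at \<open>p0 = P\<close>, where at most
      \<open>nat \<lfloor>P\<rfloor>\<close> small primes exist.\<close>
    define C :: real where "C = (2 ^ (4 * k)) ^ (1 + nat \<lfloor>P\<rfloor>)"
    have "(\<Prod>i=1..k. real (card (A i)))
          \<le> C * \<delta> powr (- (real k / (real k - 1)) - \<epsilon>) * ((\<Prod>i=1..k. X i) / D ^ k)"
      if data: "gcd_setup k X D \<delta> A" for X D \<delta> A
    proof -
      have T: "0 \<le> (\<Prod>i=1..k. X i) / D ^ k"
        using data
        by (intro divide_nonneg_nonneg prod_nonneg) (auto simp: gcd_setup_def intro: order_trans[OF zero_le_one])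
      have "1 / \<mu> \<le> real k / (real k - 1) + \<epsilon>"
      proof -
        have "\<epsilon> / ((real k - 1) * (real k - 1)) \<le> \<epsilon> / 1"
          using assms k3 mult_mono[of 1 "real k - 1" 1 "real k - 1"] by (intro divide_left_mono) auto
        then show ?thesis unfolding inv_\<mu> by (simp add: add_divide_distrib)
      qed
      then have "\<delta> powr (- (1 / \<mu>)) \<le> \<delta> powr (- (real k / (real k - 1)) - \<epsilon>)"
        using data by (intro powr_mono') (auto simp: gcd_setup_def)
      moreover have "(2 ^ (4 * k)) ^ (1 + card (prime_support_small P (\<Union>i\<in>{1..k}. A i))) \<le> C"
        unfolding C_def by (intro power_increasing add_left_mono card_prime_support_small_le) simp
      ultimately have "(2 ^ (4 * k)) ^ (1 + card (prime_support_small P (\<Union>i\<in>{1..k}. A i)))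
            * \<delta> powr (- (1 / \<mu>)) * ((\<Prod>i=1..k. X i) / D ^ k)
          \<le> C * \<delta> powr (- (real k / (real k - 1)) - \<epsilon>) * ((\<Prod>i=1..k. X i) / D ^ k)"
        using T by (intro mult_right_mono mult_mono) (auto simp: C_def)
      with bound[OF order.refl data] show ?thesis by linarith
    qed
    moreover have "C > 0" by (simp add: C_def)
    ultimately show "\<exists>C::real. C > 0 \<and>
        (\<forall>(X :: nat \<Rightarrow> real) (D :: real) (\<delta> :: real) (A :: nat \<Rightarrow> nat set).
        gcd_setup k X D \<delta> A \<longrightarrow>
        (\<Prod>i=1..k. real (card (A i)))
          \<le> C * \<delta> powr (- (real k / (real k - 1)) - \<epsilon>)
            * ((\<Prod>i=1..k. X i) / D ^ k))"
      by blast
  qed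
qed

end
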